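(* Let $\mu>0$ and $\rho>0$. Suppose that $(x(\mu),s(\mu),\lambda(\mu))\in\mathbb E\times\mathbb E\times\mathbb R^m$ solves the parameterized smooth system $$\mathcal Ax=b,\qquad \mathcal A^*\lambda+s=c,\qquad \Phi_\rho(x,s;\mu)=0.$$ Then the pair $(\hat x(\mu),s(\mu)):=(\mathcal B^*(x(\mu)-\bar x),s(\mu))$ is a saddle point of the minimax problem $$\min_{\hat x\in\hat{\mathbb E}}\max_{s\in\mathbb E}\ \eta_\rho(\hat x,s;\mu).$$ Conversely, if $(\hat x(\mu),s(\mu))$ is a saddle point of this minimax problem, then $$(x(\mu),s(\mu),\lambda(\mu)):=\big(\bar x+\mathcal B\hat x(\mu),\ s(\mu),\ (\mathcal A\mathcal A^* )^{-1}\mathcal A(c-s(\mu))\big)$$ solves the parameterized smooth system.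
   Context: $(\mathbb E,\circ)$ is a Euclidean Jordan algebra of rank $\nu$ with identity $e$ and inner product $\langle x,y\rangle=\operatorname{tr}(x\circ y)$, $\mathbb K$ its symmetric cone (cone of squares), $\phi(z)=-\ln\det z$ on $\operatorname{int}(\mathbb K)$. $\mathcal A:\mathbb E\to\mathbb R^m$ is linear and surjective with adjoint $\mathcal A^*$, $b\in\mathbb R^m$, $c\in\mathbb E$. Standing assumption (Slater): there are $x\in\operatorname{int}(\mathbb K)$ with $\mathcal Ax=b$ and $(\lambda,s)$ with $s\in\operatorname{int}(\mathbb K)$ and $\mathcal A^*\lambda+s=c$. For $x,s\in\mathbb E$, $z_\rho(x,s;\mu)$ is the unique minimizer over $z\in\operatorname{int}(\mathbb K)$ of $\mu\phi(z)+\langle s,z\rangle+\frac\rho2\|z-x\|^2$, i.e. $z_\rho(x,s;\mu)=\frac{1}{2\rho}\big(\rho x-s+((\rho x-s)^2+4\rho\mu e)^{1/2}\big)$, and $\Phi_\rho(x,s;\mu)=2(x-z_\rho(x,s;\mu))$. Fix $\bar x\in\mathbb E$ with $\mathcal A\bar x=b$, a Euclidean space $\hat{\mathbb E}$ with $\dim\hat{\mathbb E}=\dim\ker\mathcal A$, and an injective linear $\mathcal B:\hat{\mathbb E}\to\mathbb E$ with $\mathcal A\mathcal B=0$, $\mathcal B^*\mathcal B=\mathcal I$. The reduced barrier augmented Lagrangian function is, with $x=\bar x+\mathcal B\hat x$, $$\eta_\rho(\hat x,s;\mu)=\min_{z\in\operatorname{int}(\mathbb K)}\Big\{\langle c,x\rangle+\mu\phi(z)+\langle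 s,z-x\rangle+\tfrac\rho2\|z-x\|^2\Big\}.$$ A saddle point is a pair $(\hat x_*,s_* )$ with $\eta_\rho(\hat x_*,s;\mu)\le\eta_\rho(\hat x_*,s_*;\mu)\le\eta_\rho(\hat x,s_*;\mu)$ for all $\hat x\in\hat{\mathbb E}$, $s\in\mathbb E$. *)

theory Defs
  imports "HOL-Analysis.Analysis" "HOL-Library.Multiset"
begin

section \<open>Jordan algebras\<close>

class jordan_algebra = real_vector +
  fixes jmult :: "'a \<Rightarrow> 'a \<Rightarrow> 'a"  (infixl "\<circ>\<^sub>J" 70)
    and jone :: 'a
  assumes jmult_commute: "x \<circ>\<^sub>J y = y \<circ>\<^sub>J x"
    and jmult_add_left: "(x + y) \<circ>\<^sub>J z = x \<circ>\<^sub>J z + y \<circ>\<^sub>J z"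
    and jmult_scaleR_left: "(r *\<^sub>R x) \<circ>\<^sub>J y = r *\<^sub>R (x \<circ>\<^sub>J y)"
    and jordan_identity: "x \<circ>\<^sub>J ((x \<circ>\<^sub>J x) \<circ>\<^sub>J y) = (x \<circ>\<^sub>J x) \<circ>\<^sub>J (x \<circ>\<^sub>J y)"
    and jone_left: "jone \<circ>\<^sub>J x = x"

context jordan_algebra
begin

definition idempotent :: "'a \<Rightarrow> bool" where
  "idempotent c \<longleftrightarrow> c \<circ>\<^sub>J c = c"

definition primitive_idempotent :: "'a \<Rightarrow> bool" where
  "primitive_idempotent c \<longleftrightarrow> idempotent c \<and> c \<noteq> 0 \<and>
     \<not> (\<exists>p q. idempotent p \<and> idempotent q \<and> p \<noteq> 0 \<and> q \<noteq> 0 \<and> c = p + q)"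

definition jordan_frame :: "'a set \<Rightarrow> bool" where
  "jordan_frame C \<longleftrightarrow> finite C \<and> (\<forall>c\<in>C. primitive_idempotent c) \<and>
     (\<forall>c\<in>C. \<forall>d\<in>C. c \<noteq> d \<longrightarrow> c \<circ>\<^sub>J d = 0) \<and> (\<Sum>c\<in>C. c) = jone"

text \<open>
  The eigenvalues with multiplicity, read off a spectral decomposition
  \<open>x = (\<Sum>c\<in>C. l c *\<^sub>R c)\<close> along a Jordan frame. In a Euclidean Jordan algebra such a
  decomposition exists for every \<open>x\<close> and the resulting multiset depends only on \<open>x\<close>,
  so the choice is immaterial there; in other Jordan algebras the value is arbitrary.
\<close>

definition eigenvalues :: "'a \<Rightarrow> real multiset" where
  "eigenvalues x = (SOME M. \<exists>C l. jordan_frame C \<and> x = (\<Sum>c\<in>C. l c *\<^sub>R c) \<and>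
     M = image_mset l (mset_set C))"

definition jtrace :: "'a \<Rightarrow> real" where
  "jtrace x = \<Sum>\<^sub># (eigenvalues x)"

definition jdet :: "'a \<Rightarrow> real" where
  "jdet x = \<Prod>\<^sub># (eigenvalues x)"

end

primrec jpow :: "'a::jordan_algebra \<Rightarrow> nat \<Rightarrow> 'a" where
  "jpow x 0 = jone"
| "jpow x (Suc n) = x \<circ>\<^sub>J jpow x n"

text \<open>The degree of the minimal polynomial of \<open>x\<close>.\<close>

definition jdegree :: "'a::jordan_algebra \<Rightarrow> nat" where
  "jdegree x = (LEAST k. jpow x k \<in> span (jpow x ` {..<k}))"

definition jrank :: "'a::jordan_algebra itself \<Rightarrow> nat" where
  "jrank _ = Max (range (jdegree :: 'a \<Rightarrow> nat))"

text \<open>Euclidean Jordan algebras carrying the inner product given by the trace form.\<close>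

class euclidean_jordan_algebra = jordan_algebra + euclidean_space +
  assumes inner_jmult: "inner (x \<circ>\<^sub>J y) z = inner y (x \<circ>\<^sub>J z)"
    and inner_eq_jtrace: "inner x y = jtrace (x \<circ>\<^sub>J y)"

definition cone_of_squares :: "'a::jordan_algebra set" where
  "cone_of_squares = range (\<lambda>x. x \<circ>\<^sub>J x)"

section \<open>Barrier augmented Lagrangian\<close>

definition barrier :: "'e::euclidean_jordan_algebra \<Rightarrow> real" where
  "barrier z = - ln (jdet z)"

text \<open>
  For \<open>\<mu>, \<rho> > 0\<close> the objective is strictly convex and attains its minimum over the
  interior of the cone, at \<open>(w + v) / (2\<rho>)\<close> where \<open>w = \<rho>x - s\<close> and \<open>v\<close> is the square root of
  \<open>w\<^sup>2 + 4\<rho>\<mu>e\<close> in the cone.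
\<close>

definition z_min :: "real \<Rightarrow> 'e::euclidean_jordan_algebra \<Rightarrow> 'e \<Rightarrow> real \<Rightarrow> 'e" where
  "z_min \<rho> x s \<mu> =
     arg_min (\<lambda>z. \<mu> * barrier z + inner s z + \<rho> / 2 * (norm (z - x))\<^sup>2)
       (\<lambda>z. z \<in> interior cone_of_squares)"

definition Phi :: "real \<Rightarrow> 'e::euclidean_jordan_algebra \<Rightarrow> 'e \<Rightarrow> real \<Rightarrow> 'e" where
  "Phi \<rho> x s \<mu> = 2 *\<^sub>R (x - z_min \<rho> x s \<mu>)"

definition solves_smooth_system ::
    "('e::euclidean_jordan_algebra \<Rightarrow> 'f::real_inner) \<Rightarrow> 'f \<Rightarrow> 'e \<Rightarrow> real \<Rightarrow> real \<Rightarrow>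
     'e \<Rightarrow> 'e \<Rightarrow> 'f \<Rightarrow> bool" where
  "solves_smooth_system A b c \<rho> \<mu> x s l \<longleftrightarrow>
     A x = b \<and> adjoint A l + s = c \<and> Phi \<rho> x s \<mu> = 0"

text \<open>
  The minimum over \<open>z\<close> is attained for \<open>\<mu>, \<rho> > 0\<close>; \<open>LEAST\<close> denotes the least element of
  the set of objective values.
\<close>

definition eta ::
    "'e::euclidean_jordan_algebra \<Rightarrow> 'e \<Rightarrow> ('h \<Rightarrow> 'e) \<Rightarrow> real \<Rightarrow> 'h \<Rightarrow> 'e \<Rightarrow> real \<Rightarrow> real" where
  "eta c xbar B \<rho> xh s \<mu> =
     (let x = xbar + B xh in
      LEAST v. v \<in> (\<lambda>z. inner c x + \<mu> * barrier z + inner s (z - x) + \<rho> / 2 * (norm (z - x))\<^sup>2)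
        ` interior cone_of_squares)"

definition saddle_point :: "('h \<Rightarrow> 'e \<Rightarrow> real) \<Rightarrow> 'h \<Rightarrow> 'e \<Rightarrow> bool" where
  "saddle_point f xh s \<longleftrightarrow> (\<forall>s'. f xh s' \<le> f xh s) \<and> (\<forall>xh'. f xh s \<le> f xh' s)"

end

theory Submission
  imports Defs
begin

text \<open>
  Write \<open>z\<close> for the minimiser that defines \<open>eta\<close> at \<open>(xh, s)\<close>. Then \<open>eta\<close> is concave in \<open>s\<close> with gradient
  \<open>z - x\<close>, and its derivative in \<open>x\<close> along the kernel of \<open>A\<close> is \<open>c - s - \<rho> (z - x)\<close>. A saddle point is
  therefore a point with \<open>z = x\<close>, that is \<open>Phi = 0\<close>, at which \<open>c - s\<close> is orthogonal to the kernel
  of \<open>A\<close>, that is \<open>c - s\<close> lies in the range of the adjoint. The proofs of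
  \<open>saddle_point_if_smooth_system\<close> and \<open>smooth_system_if_saddle_point\<close> replace the derivatives by
  explicit inequalities, all obtained from one fact (\<open>barrier_stationary_exists\<close>): the proximal
  problem has a point \<open>z\<close> in the interior of the cone at which \<open>- (s + \<rho> (z - x))\<close> is a subgradient of
  \<open>\<mu> * barrier\<close>. Such a point is a strong minimiser, hence unique.

  That fact rests on convexity of the barrier, and this is where the Jordan algebra enters. Two elements
  \<open>z\<close> and \<open>z0\<close> of the interior have eigenvalues \<open>m d\<close> and \<open>l c\<close> along two different Jordan frames. The
  inner products \<open>c \<bullet> d\<close> of the frames form a doubly stochastic matrix
  (\<open>jordan_frames_doubly_stochastic\<close>), and averaging \<open>1 + ln t \<le> t\<close> over \<open>t = m d / l c\<close> with these
  weights is exactly the subgradient inequality for \<open>- ln det\<close> (\<open>barrier_subgradient\<close>). The same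
  weights show that the sum of the logarithms of the eigenvalues is independent of the frame.

  Two algebraic facts support this. Multiplication by an idempotent is positive semidefinite
  (\<open>inner_jmult_idempotent\<close>), which makes the weights nonnegative. Every element has a decomposition
  along a Jordan frame (\<open>spectral_decomposition\<close>): multiplication by \<open>x\<close> is diagonalised on the span of the
  powers of \<open>x\<close>, the components of the identity are orthogonal idempotents, and a refinement of maximal
  cardinality is primitive.
\<close>

section \<open>Consequences of the Jordan identity\<close>

lemma linear_jmult: "linear ((\<circ>\<^sub>J) (x::'a::jordan_algebra))"
  by (rule linearI) (metis jmult_commute jmult_add_left, metis jmult_commute jmult_scaleR_left)

lemmas jmult_add_right = linear_add[OF linear_jmult]
  and jmult_scaleR_right = linear_scale[OF linear_jmult]
  and jmult_zero_right = linear_0[OF linear_jmult]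
  and jmult_sum_right = linear_sum[OF linear_jmult]

lemma jmult_zero_left: "0 \<circ>\<^sub>J x = (0::'a::jordan_algebra)"
  by (metis jmult_commute jmult_zero_right)

lemma jone_right: "x \<circ>\<^sub>J jone = (x::'a::jordan_algebra)"
  by (metis jmult_commute jone_left)

text \<open>
  The Jordan identity is cubic in \<open>x\<close>; its full polarisation is trilinear. The inclusion-exclusion
  sum over \<open>x + y + z\<close>, the pairwise sums and the single elements leaves exactly the mixed part.
  Testing against a vector \<open>u\<close> turns the comparison into real linear arithmetic.
\<close>

lemma jordan_linearised:
  fixes x y z w :: "'a::euclidean_jordan_algebra"
  shows "x \<circ>\<^sub>J ((y \<circ>\<^sub>J z) \<circ>\<^sub>J w) + y \<circ>\<^sub>J ((z \<circ>\<^sub>J x) \<circ>\<^sub>J w) + z \<circ>\<^sub>J ((x \<circ>\<^sub>J y) \<circ>\<^sub>J w) =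
    (y \<circ>\<^sub>J z) \<circ>\<^sub>J (x \<circ>\<^sub>J w) + (z \<circ>\<^sub>J x) \<circ>\<^sub>J (y \<circ>\<^sub>J w) + (x \<circ>\<^sub>J y) \<circ>\<^sub>J (z \<circ>\<^sub>J w)"
proof (rule vector_eq_ldot[THEN iffD1], rule allI)
  fix u :: 'a
  define J where "J a = u \<bullet> (a \<circ>\<^sub>J ((a \<circ>\<^sub>J a) \<circ>\<^sub>J w)) - u \<bullet> ((a \<circ>\<^sub>J a) \<circ>\<^sub>J (a \<circ>\<^sub>J w))" for a
  have "J a = 0" for a
    unfolding J_def using jordan_identity[of a w] by simp
  then have "J (x + y + z) - J (x + y) - J (y + z) - J (x + z) + J x + J y + J z = 0"
    by simp
  then show "u \<bullet> (x \<circ>\<^sub>J ((y \<circ>\<^sub>J z) \<circ>\<^sub>J w) + y \<circ>\<^sub>J ((z \<circ>\<^sub>J x) \<circ>\<^sub>J w) + z \<circ>\<^sub>J ((x \<circ>\<^sub>J y) \<circ>\<^sub>J w)) =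
    u \<bullet> ((y \<circ>\<^sub>J z) \<circ>\<^sub>J (x \<circ>\<^sub>J w) + (z \<circ>\<^sub>J x) \<circ>\<^sub>J (y \<circ>\<^sub>J w) + (x \<circ>\<^sub>J y) \<circ>\<^sub>J (z \<circ>\<^sub>J w))"
    unfolding J_def jmult_add_left jmult_add_right inner_add_right
    by (simp add: jmult_commute[of y x] jmult_commute[of z x] jmult_commute[of z y])
qed

text \<open>
  The polarised identity, regarded as a function of \<open>z\<close>, writes multiplication by a product of three
  elements through multiplications by the elements themselves and by their pairwise products.
\<close>

lemma jmult_triple:
  fixes x y z w :: "'a::euclidean_jordan_algebra"
  shows "((x \<circ>\<^sub>J y) \<circ>\<^sub>J w) \<circ>\<^sub>J z = (x \<circ>\<^sub>J w) \<circ>\<^sub>J (y \<circ>\<^sub>J z) + (y \<circ>\<^sub>J w) \<circ>\<^sub>J (x \<circ>\<^sub>J z)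
    + (x \<circ>\<^sub>J y) \<circ>\<^sub>J (w \<circ>\<^sub>J z) - x \<circ>\<^sub>J (w \<circ>\<^sub>J (y \<circ>\<^sub>J z)) - y \<circ>\<^sub>J (w \<circ>\<^sub>J (x \<circ>\<^sub>J z))"
proof -
  have "((x \<circ>\<^sub>J y) \<circ>\<^sub>J w) \<circ>\<^sub>J z = z \<circ>\<^sub>J ((x \<circ>\<^sub>J y) \<circ>\<^sub>J w)"
    and "w \<circ>\<^sub>J z = z \<circ>\<^sub>J w" "w \<circ>\<^sub>J (y \<circ>\<^sub>J z) = (y \<circ>\<^sub>J z) \<circ>\<^sub>J w" "w \<circ>\<^sub>J (x \<circ>\<^sub>J z) = (z \<circ>\<^sub>J x) \<circ>\<^sub>J w"
    "(y \<circ>\<^sub>J w) \<circ>\<^sub>J (x \<circ>\<^sub>J z) = (z \<circ>\<^sub>J x) \<circ>\<^sub>J (y \<circ>\<^sub>J w)" "(x \<circ>\<^sub>J w) \<circ>\<^sub>J (y \<circ>\<^sub>J z) = (y \<circ>\<^sub>J z) \<circ>\<^sub>J (x \<circ>\<^sub>J w)"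
    by (simp_all add: jmult_commute)
  then show ?thesis
    using jordan_linearised[of x y z w] by (simp add: algebra_simps)
qed

text \<open>
  This is the part of power associativity that the spectral theorem needs. By the previous lemma,
  multiplication by \<open>x\<^sup>n\<^sup>+\<^sup>2\<close> is a polynomial in multiplications by \<open>x\<close>, \<open>x\<^sup>2\<close>, \<open>x\<^sup>n\<close> and \<open>x\<^sup>n\<^sup>+\<^sup>1\<close>,
  so an operator commuting with the multiplications by \<open>x\<close> and \<open>x\<^sup>2\<close> commutes with all of them.
\<close>

lemma jmult_jpow_commute:
  fixes x :: "'a::euclidean_jordan_algebra"
  assumes T: "linear T"
    and 1: "\<And>w. T (x \<circ>\<^sub>J w) = x \<circ>\<^sub>J T w"
    and 2: "\<And>w. T ((x \<circ>\<^sub>J x) \<circ>\<^sub>J w) = (x \<circ>\<^sub>J x) \<circ>\<^sub>J T w"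
  shows "T (jpow x n \<circ>\<^sub>J w) = jpow x n \<circ>\<^sub>J T w"
proof (induction n arbitrary: w rule: induct_nat_012)
  case 0
  then show ?case by (simp add: jone_left)
next
  case 1
  then show ?case by (simp add: jone_right assms(2))
next
  case (ge2 n)
  have pow: "jpow x (Suc (Suc n)) \<circ>\<^sub>J v = (x \<circ>\<^sub>J x) \<circ>\<^sub>J (jpow x n \<circ>\<^sub>J v)
      + jpow x (Suc n) \<circ>\<^sub>J (x \<circ>\<^sub>J v) + jpow x (Suc n) \<circ>\<^sub>J (x \<circ>\<^sub>J v)
      - x \<circ>\<^sub>J (x \<circ>\<^sub>J (jpow x n \<circ>\<^sub>J v)) - jpow x n \<circ>\<^sub>J (x \<circ>\<^sub>J (x \<circ>\<^sub>J v))" for v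
    using jmult_triple[of x "jpow x n" x v]
    by (simp add: jmult_commute[of "x \<circ>\<^sub>J jpow x n" x] jmult_commute[of "jpow x n" x])
  show ?case
    unfolding pow by (simp only: linear_add[OF T] linear_diff[OF T] 1 2 ge2)
qed

text \<open>
  Multiplication by an idempotent is annihilated by \<open>2t\<^sup>3 - 3t\<^sup>2 + t\<close>; its eigenvalues are
  among \<open>0\<close>, \<open>1/2\<close> and \<open>1\<close> (Peirce decomposition).
\<close>

lemma idempotent_jmult_cubic:
  fixes c v :: "'a::euclidean_jordan_algebra"
  assumes "idempotent c"
  shows "c \<circ>\<^sub>J v = 3 *\<^sub>R (c \<circ>\<^sub>J (c \<circ>\<^sub>J v)) - 2 *\<^sub>R (c \<circ>\<^sub>J (c \<circ>\<^sub>J (c \<circ>\<^sub>J v)))"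
proof -
  have "(c \<circ>\<^sub>J c) = c" using assms by (simp add: idempotent_def)
  moreover have "3 *\<^sub>R a = a + a + a" for a :: 'a
    using scaleR_add_left[of 2 1 a] by (simp add: scaleR_2)
  ultimately show ?thesis
    using jmult_triple[of c c c v] by (simp add: scaleR_2 algebra_simps)
qed

text \<open>
  On the three possible eigenvalues \<open>0\<close>, \<open>1/2\<close>, \<open>1\<close> one has \<open>t = t\<^sup>2 + 4(t - t\<^sup>2)\<^sup>2\<close>. For the
  symmetric operator of multiplication by \<open>c\<close> this yields a sum of squares, which shows both that the
  operator is positive semidefinite and that the form vanishes at \<open>v\<close> only if \<open>c \<circ>\<^sub>J v = 0\<close>.
\<close>

lemma inner_jmult_idempotent:
  fixes c v :: "'a::euclidean_jordan_algebra"
  assumes "idempotent c"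
  shows "(c \<circ>\<^sub>J v) \<bullet> v = (norm (c \<circ>\<^sub>J v))\<^sup>2 + 4 * (norm (c \<circ>\<^sub>J v - c \<circ>\<^sub>J (c \<circ>\<^sub>J v)))\<^sup>2"
proof -
  define p q r where "p = c \<circ>\<^sub>J v" and "q = c \<circ>\<^sub>J p" and "r = c \<circ>\<^sub>J q"
  have "p = 3 *\<^sub>R q - 2 *\<^sub>R r"
    unfolding p_def q_def r_def using idempotent_jmult_cubic[OF assms] .
  then have "2 *\<^sub>R r = 3 *\<^sub>R q - p" by (simp add: algebra_simps)
  then have "(1/2) *\<^sub>R (2 *\<^sub>R r) = (1/2) *\<^sub>R (3 *\<^sub>R q - p)" by (simp only:)
  then have r: "r = (3/2) *\<^sub>R q - (1/2) *\<^sub>R p" by (simp add: scaleR_diff_right)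
  have sym: "(c \<circ>\<^sub>J a) \<bullet> b = a \<bullet> (c \<circ>\<^sub>J b)" for a b :: 'a by (rule inner_jmult)
  have "q \<bullet> v = p \<bullet> p" "r \<bullet> v = q \<bullet> p" "r \<bullet> p = q \<bullet> q"
    unfolding p_def q_def r_def by (simp_all add: sym)
  then show ?thesis
    unfolding p_def[symmetric] q_def[symmetric] r
    by (simp add: power2_norm_eq_inner algebra_simps inner_commute)
qed

section \<open>Symmetric operators\<close>

text \<open>
  A maximiser \<open>v\<close> of the Rayleigh quotient over the unit sphere of \<open>W\<close>, with maximum \<open>r\<close>, makes
  \<open>S = r - T\<close> positive semidefinite on \<open>W\<close> with \<open>S v \<bullet> v = 0\<close>, and a semidefinite form vanishes
  at a vector only if the vector lies in the kernel.
\<close>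

lemma symmetric_operator_eigenvector:
  fixes T :: "'a::euclidean_space \<Rightarrow> 'a"
  assumes T: "linear T" and sym: "\<And>v w. T v \<bullet> w = v \<bullet> T w"
    and W: "subspace W" "T ` W \<subseteq> W" "W \<noteq> {0}"
  obtains v r where "v \<in> W" "v \<noteq> 0" "T v = r *\<^sub>R v"
proof -
  have "compact (sphere 0 1 \<inter> W)"
    using closed_subspace[OF W(1)] by (intro compact_Int_closed) auto
  moreover have "sphere 0 1 \<inter> W \<noteq> {}"
  proof -
    obtain w where "w \<in> W" "w \<noteq> 0"
      using W subspace_0 by blast
    then have "w /\<^sub>R norm w \<in> sphere 0 1 \<inter> W"
      using subspace_scale[OF W(1)] by simp
    then show ?thesis by blast
  qed
  moreover have "continuous_on (sphere 0 1 \<inter> W) (\<lambda>w. T w \<bullet> w)"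
    using T by (intro continuous_intros linear_continuous_on) (simp add: linear_conv_bounded_linear)
  ultimately obtain v where v: "v \<in> sphere 0 1 \<inter> W"
    and max: "\<forall>w \<in> sphere 0 1 \<inter> W. T w \<bullet> w \<le> T v \<bullet> v"
    using continuous_attains_sup by blast
  define r where "r = T v \<bullet> v"
  define S where "S w = r *\<^sub>R w - T w" for w
  have "v \<bullet> v = 1" and "v \<in> W" using v by (simp_all add: norm_eq_1)
  have S_add: "S (a + b) = S a + S b" and S_scale: "S (t *\<^sub>R a) = t *\<^sub>R S a" for a b t
    unfolding S_def using linear_add[OF T] linear_scale[OF T] by (simp_all add: algebra_simps)
  have S_sym: "S a \<bullet> b = a \<bullet> S b" for a b
    unfolding S_def by (simp add: inner_diff_left inner_diff_right sym)
  have S_nonneg: "0 \<le> S w \<bullet> w" if "w \<in> W" for w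
  proof (cases "w = 0")
    case False
    define u where "u = w /\<^sub>R norm w"
    have "u \<in> sphere 0 1 \<inter> W"
      using False that subspace_scale[OF W(1)] by (simp add: u_def)
    moreover from this have "u \<bullet> u = 1" by (simp add: norm_eq_1)
    ultimately have "0 \<le> S u \<bullet> u"
      using max by (simp add: S_def r_def inner_diff_left)
    moreover have "w = norm w *\<^sub>R u" using False by (simp add: u_def)
    then have "S w \<bullet> w = (norm w * norm w) * (S u \<bullet> u)" by (metis S_scale inner_scaleR_left inner_scaleR_right mult.assoc)
    ultimately show ?thesis by simp
  qed simp
  have "S v \<in> W"
    unfolding S_def using W \<open>v \<in> W\<close> by (intro subspace_diff subspace_scale) auto
  have "S v = 0"
  proof (rule ccontr)
    assume "S v \<noteq> 0"
    then have pos: "0 < S v \<bullet> S v" by simp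
    \<comment> \<open>The form decreases to first order along \<open>- S v\<close>, so a short step makes it negative.\<close>
    define d where "d = S (S v) \<bullet> S v"
    have "0 \<le> d" unfolding d_def using S_nonneg \<open>S v \<in> W\<close> .
    \<comment> \<open>The \<open>1\<close> in the denominator covers \<open>d = 0\<close>.\<close>
    define t where "t = (S v \<bullet> S v) / (d + 1)"
    have "0 < t" using pos \<open>0 \<le> d\<close> by (simp add: t_def)
    have "v + (- t) *\<^sub>R S v \<in> W"
      using W \<open>v \<in> W\<close> \<open>S v \<in> W\<close> by (intro subspace_add subspace_scale)
    then have "0 \<le> S (v + (- t) *\<^sub>R S v) \<bullet> (v + (- t) *\<^sub>R S v)" by (rule S_nonneg)
    also have "\<dots> = S v \<bullet> v - 2 * t * (S v \<bullet> S v) + t * t * d"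
      unfolding S_add S_scale d_def
      by (simp add: algebra_simps S_sym[of "S v" v])
    also have "S v \<bullet> v = 0"
      using \<open>v \<bullet> v = 1\<close> by (simp add: S_def r_def inner_diff_left)
    also have "0 - 2 * t * (S v \<bullet> S v) + t * t * d = t * (t * d - 2 * (S v \<bullet> S v))"
      by (simp add: algebra_simps)
    finally have "2 * (S v \<bullet> S v) \<le> t * d"
      using \<open>0 < t\<close> by (simp add: zero_le_mult_iff)
    moreover have "t * d \<le> S v \<bullet> S v"
      using pos \<open>0 \<le> d\<close> by (simp add: t_def field_simps)
    ultimately show False using pos by linarith
  qed
  then have "T v = r *\<^sub>R v" by (simp add: S_def)
  moreover have "v \<noteq> 0" using \<open>v \<bullet> v = 1\<close> by auto
  ultimately show thesis using that \<open>v \<in> W\<close> by blast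
qed

text \<open>
  The vectors of \<open>V\<close> orthogonal to all eigenvectors form an invariant subspace; if it were nonzero, it
  would contain an eigenvector orthogonal to itself.
\<close>

lemma symmetric_operator_eigenvectors_span:
  fixes T :: "'a::euclidean_space \<Rightarrow> 'a"
  assumes T: "linear T" and sym: "\<And>v w. T v \<bullet> w = v \<bullet> T w"
    and V: "subspace V" "T ` V \<subseteq> V"
  shows "V \<subseteq> span {v \<in> V. \<exists>r. T v = r *\<^sub>R v}" (is "V \<subseteq> span ?E")
proof (rule ccontr)
  assume neq: "\<not> V \<subseteq> span ?E"
  define W where "W = {w \<in> V. \<forall>v \<in> ?E. v \<bullet> w = 0}"
  have "subspace W"
    using V(1) unfolding W_def subspace_def by (auto simp: inner_add_right)
  moreover have "T ` W \<subseteq> W"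
  proof
    fix y assume "y \<in> T ` W"
    then obtain w where w: "y = T w" "w \<in> W" by blast
    have "v \<bullet> T w = 0" if "v \<in> ?E" for v
    proof -
      obtain r where r: "T v = r *\<^sub>R v" using \<open>v \<in> ?E\<close> by blast
      have "v \<bullet> T w = T v \<bullet> w" by (rule sym[symmetric])
      also have "\<dots> = r * (v \<bullet> w)" by (simp add: r)
      also have "v \<bullet> w = 0" using w(2) that unfolding W_def by blast
      finally show ?thesis by simp
    qed
    then show "y \<in> W" using w V(2) unfolding W_def by blast
  qed
  moreover have "W \<noteq> {0}"
  proof -
    obtain x where x: "x \<in> V" "x \<notin> span ?E" using neq by blast
    obtain y z where yz: "y \<in> span ?E" "\<And>w. w \<in> span ?E \<Longrightarrow> orthogonal z w" "x = y + z"
      using orthogonal_subspace_decomp_exists by blast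
    have "y \<in> V" using yz(1) span_minimal[of ?E V] V(1) by auto
    then have "z \<in> V" using yz(3) x(1) V(1) subspace_diff[of V x y] by simp
    moreover have "v \<bullet> z = 0" if "v \<in> ?E" for v
      using yz(2)[OF span_base[OF that]] by (simp only: orthogonal_def inner_commute)
    ultimately have "z \<in> W" unfolding W_def by blast
    moreover have "z \<noteq> 0" using x yz by auto
    ultimately show ?thesis by blast
  qed
  ultimately obtain v r where v: "v \<in> W" "v \<noteq> 0" "T v = r *\<^sub>R v"
    using symmetric_operator_eigenvector[OF T sym] by blast
  then have "v \<in> ?E" unfolding W_def by blast
  then have "v \<bullet> v = 0" using v(1) unfolding W_def by blast
  then show False using v(2) by simp
qed

section \<open>Spectral theorem\<close>

text \<open>
  The spectral decomposition of \<open>x\<close> with distinct eigenvalues. On the span \<open>V\<close> of the powers of \<open>x\<close>,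
  multiplication by \<open>x\<close> is symmetric, so the identity is a sum of eigenvectors \<open>p r\<close> in \<open>V\<close>.
  Multiplication by an element of \<open>V\<close> commutes with multiplication by \<open>x\<close>, which makes \<open>p r \<circ>\<^sub>J p s\<close>
  an eigenvector for both \<open>r\<close> and \<open>s\<close>, hence zero for \<open>r \<noteq> s\<close>. Multiplying the
  decomposition of the identity by \<open>p r\<close> then gives that \<open>p r\<close> is idempotent.
\<close>

lemma spectral_projections:
  fixes x :: "'a::euclidean_jordan_algebra"
  obtains R p where "finite R" "jone = (\<Sum>r\<in>R. p r)"
    "\<And>r. r \<in> R \<Longrightarrow> x \<circ>\<^sub>J p r = r *\<^sub>R p r"
    "\<And>r. r \<in> R \<Longrightarrow> idempotent (p r)"
    "\<And>r s. r \<in> R \<Longrightarrow> s \<in> R \<Longrightarrow> r \<noteq> s \<Longrightarrow> p r \<circ>\<^sub>J p s = 0"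
proof -
  define V where "V = span (range (jpow x))"
  define E where "E = {v \<in> V. \<exists>r. x \<circ>\<^sub>J v = r *\<^sub>R v}"
  have V_comm: "x \<circ>\<^sub>J (b \<circ>\<^sub>J w) = b \<circ>\<^sub>J (x \<circ>\<^sub>J w)" if "b \<in> V" for b w
    using that unfolding V_def
  proof (induction rule: span_induct_alt)
    case base
    then show ?case by (simp add: jmult_zero_left jmult_zero_right)
  next
    case (step t a b)
    then obtain n where "a = jpow x n" by blast
    then have "x \<circ>\<^sub>J (a \<circ>\<^sub>J w) = a \<circ>\<^sub>J (x \<circ>\<^sub>J w)"
      using jmult_jpow_commute[OF linear_jmult, of x x n w] by (simp add: jordan_identity)
    then show ?case
      using step.IH by (simp add: jmult_add_left jmult_add_right jmult_scaleR_left jmult_scaleR_right)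
  qed
  have "x \<circ>\<^sub>J b \<in> V" if "b \<in> V" for b
    using that unfolding V_def
  proof (induction rule: span_induct_alt)
    case base
    then show ?case by (simp add: jmult_zero_right span_zero)
  next
    case (step t a b)
    then obtain n where "a = jpow x n" by blast
    then have "x \<circ>\<^sub>J a = jpow x (Suc n)" by simp
    then have "x \<circ>\<^sub>J a \<in> span (range (jpow x))" by (metis rangeI span_base)
    then show ?case
      using step.IH by (simp add: jmult_add_right jmult_scaleR_right span_add span_scale)
  qed
  then have "V \<subseteq> span E"
    unfolding E_def V_def
    by (intro symmetric_operator_eigenvectors_span) (auto simp: linear_jmult inner_jmult)
  moreover have "jone \<in> V"
    unfolding V_def by (metis jpow.simps(1) rangeI span_base)
  ultimately have "jone \<in> span E" by blast
  then obtain S u where S: "finite S" "S \<subseteq> E" "jone = (\<Sum>v\<in>S. u v *\<^sub>R v)"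
    unfolding span_explicit by blast
  then have "\<forall>v\<in>S. \<exists>r. x \<circ>\<^sub>J v = r *\<^sub>R v" by (auto simp: E_def)
  then obtain ev where ev: "\<And>v. v \<in> S \<Longrightarrow> x \<circ>\<^sub>J v = ev v *\<^sub>R v" by metis
  define R where "R = ev ` S"
  define p where "p r = (\<Sum>v\<in>{v \<in> S. ev v = r}. u v *\<^sub>R v)" for r
  have fin: "finite R" using S by (simp add: R_def)
  have one: "jone = (\<Sum>r\<in>R. p r)"
    unfolding p_def R_def S(3) by (rule sum.image_gen[OF S(1)])
  have eig: "x \<circ>\<^sub>J p r = r *\<^sub>R p r" for r
    by (auto simp: p_def jmult_sum_right jmult_scaleR_right ev scaleR_right.sum
        intro!: sum.cong)
  have pV: "p r \<in> V" for r
    unfolding p_def using S(2) by (auto simp: V_def E_def intro!: span_sum span_scale)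
  have orth: "p r \<circ>\<^sub>J p s = 0" if "r \<noteq> s" for r s
  proof -
    have "r *\<^sub>R (p r \<circ>\<^sub>J p s) = p s \<circ>\<^sub>J (x \<circ>\<^sub>J p r)"
      by (metis eig jmult_commute jmult_scaleR_left)
    also have "\<dots> = x \<circ>\<^sub>J (p s \<circ>\<^sub>J p r)" by (rule V_comm[OF pV, symmetric])
    also have "\<dots> = x \<circ>\<^sub>J (p r \<circ>\<^sub>J p s)" by (simp add: jmult_commute)
    also have "\<dots> = p r \<circ>\<^sub>J (x \<circ>\<^sub>J p s)" by (rule V_comm[OF pV])
    also have "\<dots> = s *\<^sub>R (p r \<circ>\<^sub>J p s)" by (simp add: eig jmult_scaleR_right)
    finally show ?thesis using that by simp
  qed
  have "idempotent (p r)" if "r \<in> R" for r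
  proof -
    have "p r = p r \<circ>\<^sub>J (\<Sum>s\<in>R. p s)" by (simp add: one[symmetric] jone_right)
    also have "\<dots> = (\<Sum>s\<in>R. if s = r then p r \<circ>\<^sub>J p r else 0)"
      unfolding jmult_sum_right using orth by (intro sum.cong) auto
    also have "\<dots> = p r \<circ>\<^sub>J p r" using that fin by simp
    finally show ?thesis by (simp add: idempotent_def)
  qed
  then show thesis using that[OF fin one eig] orth by blast
qed

lemma inner_idempotents_nonneg:
  fixes p q :: "'a::euclidean_jordan_algebra"
  assumes "idempotent p" "idempotent q"
  shows "0 \<le> p \<bullet> q"
proof -
  have "p \<bullet> q = p \<bullet> (q \<circ>\<^sub>J q)" using assms by (simp add: idempotent_def)
  also have "\<dots> = (p \<circ>\<^sub>J q) \<bullet> q" by (metis inner_jmult jmult_commute)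
  finally show ?thesis
    by (simp add: inner_jmult_idempotent[OF assms(1)])
qed

lemma idempotents_inner_eq_0D:
  fixes p q :: "'a::euclidean_jordan_algebra"
  assumes "idempotent p" "idempotent q" "p \<bullet> q = 0"
  shows "p \<circ>\<^sub>J q = 0"
proof -
  have "p \<bullet> q = p \<bullet> (q \<circ>\<^sub>J q)" using assms by (simp add: idempotent_def)
  also have "\<dots> = (p \<circ>\<^sub>J q) \<bullet> q" by (metis inner_jmult jmult_commute)
  finally have "(norm (p \<circ>\<^sub>J q))\<^sup>2 + 4 * (norm (p \<circ>\<^sub>J q - p \<circ>\<^sub>J (p \<circ>\<^sub>J q)))\<^sup>2 = 0"
    using assms(3) by (simp add: inner_jmult_idempotent[OF assms(1)])
  then have "(norm (p \<circ>\<^sub>J q))\<^sup>2 = 0"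
    by (smt (verit) zero_le_power2)
  then show ?thesis by simp
qed

lemma orthogonal_idempotents_inner:
  fixes p q :: "'a::euclidean_jordan_algebra"
  assumes "idempotent p" "p \<circ>\<^sub>J q = 0"
  shows "p \<bullet> q = 0"
  using assms by (metis idempotent_def inner_jmult inner_zero_right)

lemma idempotent_summands_orthogonal:
  fixes p q :: "'a::jordan_algebra"
  assumes "idempotent p" "idempotent q" "idempotent (p + q)"
  shows "p \<circ>\<^sub>J q = 0"
proof -
  have "(p + q) \<circ>\<^sub>J (p + q) = p + q" using assms(3) by (simp add: idempotent_def)
  then have "2 *\<^sub>R (p \<circ>\<^sub>J q) = 0"
    using assms(1,2) 
    by (simp add: idempotent_def jmult_add_left jmult_add_right jmult_commute[of q p] scaleR_2 add.commute add.left_commute)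
  then show ?thesis by simp
qed

text \<open>
  A complete system of orthogonal idempotents: a Jordan frame without the primitivity requirement,
  so that such systems can be refined.
\<close>

definition idempotent_system :: "'a::jordan_algebra set \<Rightarrow> bool" where
  "idempotent_system C \<longleftrightarrow> finite C \<and> (\<forall>c\<in>C. idempotent c \<and> c \<noteq> 0) \<and>
     (\<forall>c\<in>C. \<forall>d\<in>C. c \<noteq> d \<longrightarrow> c \<circ>\<^sub>J d = 0) \<and> (\<Sum>c\<in>C. c) = jone"

lemma jordan_frame_iff_idempotent_system:
  "jordan_frame C \<longleftrightarrow> idempotent_system C \<and> (\<forall>c\<in>C. primitive_idempotent c)"
  by (auto simp: jordan_frame_def idempotent_system_def primitive_idempotent_def)

lemma idempotent_system_jmult:
  assumes "idempotent_system C" "c \<in> C"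
  shows "c \<circ>\<^sub>J (\<Sum>d\<in>C. l d *\<^sub>R d) = l c *\<^sub>R c"
proof -
  have "c \<circ>\<^sub>J (\<Sum>d\<in>C. l d *\<^sub>R d) = (\<Sum>d\<in>C. if d = c then l c *\<^sub>R c else 0)"
    unfolding jmult_sum_right using assms
    by (intro sum.cong) (auto simp: jmult_scaleR_right idempotent_system_def idempotent_def)
  then show ?thesis using assms by (simp add: idempotent_system_def)
qed

lemma idempotent_system_square:
  assumes "idempotent_system C"
  shows "(\<Sum>c\<in>C. l c *\<^sub>R c) \<circ>\<^sub>J (\<Sum>c\<in>C. l c *\<^sub>R c) = (\<Sum>c\<in>C. (l c * l c) *\<^sub>R c)"
proof -
  let ?x = "\<Sum>c\<in>C. l c *\<^sub>R c"
  have "?x \<circ>\<^sub>J ?x = (\<Sum>c\<in>C. l c *\<^sub>R (c \<circ>\<^sub>J ?x))"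
    by (subst (2) jmult_commute) (simp add: jmult_sum_right jmult_scaleR_right jmult_commute[of _ ?x])
  then show ?thesis by (simp add: idempotent_system_jmult[OF assms])
qed

text \<open>
  Orthogonality for the Jordan product implies orthogonality for the inner product.
\<close>

lemma idempotent_system_card_le:
  fixes C :: "'a::euclidean_jordan_algebra set"
  assumes "idempotent_system C"
  shows "card C \<le> DIM('a)"
proof -
  have "pairwise orthogonal C" "0 \<notin> C"
    using assms unfolding idempotent_system_def pairwise_def orthogonal_def
    by (blast intro: orthogonal_idempotents_inner)+
  then show ?thesis
    using independent_bound[OF pairwise_orthogonal_independent] by blast
qed

text \<open>
  Any member other than \<open>p + q\<close> is orthogonal to the sum, and since inner products of idempotents are
  nonnegative it is orthogonal to \<open>p\<close> and to \<open>q\<close> separately. This is why replacing \<open>p + q\<close> by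
  its two summands keeps the system orthogonal.
\<close>

lemma idempotent_system_split:
  fixes C :: "'a::euclidean_jordan_algebra set"
  assumes C: "idempotent_system C" "p + q \<in> C"
    and p: "idempotent p" "p \<noteq> 0" and q: "idempotent q" "q \<noteq> 0"
  shows "idempotent_system (insert p (insert q (C - {p + q})))"
    and "card (insert p (insert q (C - {p + q}))) = Suc (card C)"
proof -
  have fin: "finite C" and idem: "\<And>d. d \<in> C \<Longrightarrow> idempotent d \<and> d \<noteq> 0" and one: "(\<Sum>c\<in>C. c) = jone"
    and orth: "\<And>c d. c \<in> C \<Longrightarrow> d \<in> C \<Longrightarrow> c \<noteq> d \<Longrightarrow> c \<circ>\<^sub>J d = 0"
    using C(1) by (auto simp: idempotent_system_def)
  have pq: "p \<circ>\<^sub>J q = 0" "q \<circ>\<^sub>J p = 0"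
    using idempotent_summands_orthogonal idem[OF C(2)] p(1) q(1) jmult_commute by metis+
  have pd: "p \<circ>\<^sub>J d = 0 \<and> q \<circ>\<^sub>J d = 0 \<and> d \<circ>\<^sub>J p = 0 \<and> d \<circ>\<^sub>J q = 0" if "d \<in> C - {p + q}" for d
  proof -
    have "idempotent d" using idem that by blast
    have "(p + q) \<bullet> d = 0"
      using orthogonal_idempotents_inner[of "p + q" d] orth[OF C(2), of d] idem[OF C(2)] that by auto
    then have "p \<bullet> d + q \<bullet> d = 0" by (simp add: inner_add_left)
    then have "p \<bullet> d = 0" "q \<bullet> d = 0"
      using inner_idempotents_nonneg[OF p(1) \<open>idempotent d\<close>]
        inner_idempotents_nonneg[OF q(1) \<open>idempotent d\<close>] by linarith+
    then show ?thesis
      using idempotents_inner_eq_0D \<open>idempotent d\<close> p(1) q(1) jmult_commute by metis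
  qed
  have notin: "p \<notin> C - {p + q}" "q \<notin> C - {p + q}" "p \<noteq> q"
    using pd pq p q unfolding idempotent_def by metis+
  have "(\<Sum>c\<in>insert p (insert q (C - {p + q})). c) = p + (q + (\<Sum>c\<in>C - {p + q}. c))"
    using fin notin by simp
  also have "\<dots> = jone"
    using one fin C(2) by (simp add: sum.remove[of C "p + q"] add.assoc)
  finally show "idempotent_system (insert p (insert q (C - {p + q})))"
    unfolding idempotent_system_def using fin idem orth p q pq pd by auto
  have "card C > 0" using fin C(2) by (auto simp: card_gt_0_iff)
  then show "card (insert p (insert q (C - {p + q}))) = Suc (card C)"
    using fin notin C(2) by simp
qed

text \<open>
  The spectral projections of \<open>x\<close> form a complete system whose span contains \<open>x\<close>. Among all such
  systems one of maximal cardinality consists of primitive idempotents, because a member that splits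
  would allow a refinement that is larger and still spans \<open>x\<close>.
\<close>

lemma spectral_decomposition:
  fixes x :: "'a::euclidean_jordan_algebra"
  obtains C l where "jordan_frame C" "x = (\<Sum>c\<in>C. l c *\<^sub>R c)"
proof -
  let ?P = "\<lambda>C. idempotent_system C \<and> x \<in> span C"
  obtain R p where R: "finite R" "jone = (\<Sum>r\<in>R. p r)"
    and eig: "\<And>r. r \<in> R \<Longrightarrow> x \<circ>\<^sub>J p r = r *\<^sub>R p r"
    and idem: "\<And>r. r \<in> R \<Longrightarrow> idempotent (p r)"
    and orth: "\<And>r s. r \<in> R \<Longrightarrow> s \<in> R \<Longrightarrow> r \<noteq> s \<Longrightarrow> p r \<circ>\<^sub>J p s = 0"
    using spectral_projections[of x] by blast
  \<comment> \<open>Some of the projections may vanish; these are dropped.\<close>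
  define R' where "R' = {r \<in> R. p r \<noteq> 0}"
  have inj: "inj_on p R'"
    using idem orth unfolding inj_on_def R'_def idempotent_def by force
  have "(\<Sum>c\<in>p ` R'. c) = (\<Sum>r\<in>R'. p r)" by (simp add: sum.reindex[OF inj])
  also have "\<dots> = (\<Sum>r\<in>R. p r)"
    using R(1) by (intro sum.mono_neutral_left) (auto simp: R'_def)
  finally have one: "(\<Sum>c\<in>p ` R'. c) = jone" using R(2) by simp
  have "idempotent_system (p ` R')"
    unfolding idempotent_system_def using one R(1) idem orth by (auto simp: R'_def)
  moreover have "x \<in> span (p ` R')"
  proof -
    have "x = x \<circ>\<^sub>J (\<Sum>c\<in>p ` R'. c)" by (simp add: one jone_right)
    also have "\<dots> = (\<Sum>r\<in>R'. r *\<^sub>R p r)"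
      unfolding jmult_sum_right sum.reindex[OF inj] by (intro sum.cong) (auto simp: eig R'_def)
    finally have "x = (\<Sum>r\<in>R'. r *\<^sub>R p r)" .
    moreover have "(\<Sum>r\<in>R'. r *\<^sub>R p r) \<in> span (p ` R')"
      by (intro span_sum span_scale span_base imageI)
    ultimately show ?thesis by simp
  qed
  ultimately have start: "?P (p ` R')" by blast
  have bound: "\<forall>C. ?P C \<longrightarrow> card C < Suc DIM('a)"
    using idempotent_system_card_le le_imp_less_Suc by blast
  obtain C where C: "?P C" and max: "\<And>D. ?P D \<Longrightarrow> card D \<le> card C"
    using ex_has_greatest_nat[of ?P, OF start bound] by (elim exE conjE) simp
  have "primitive_idempotent c" if "c \<in> C" for c
  proof (rule ccontr)
    assume "\<not> primitive_idempotent c"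
    moreover have "idempotent c" "c \<noteq> 0"
      using C that by (auto simp: idempotent_system_def)
    ultimately obtain a b where ab: "idempotent a" "a \<noteq> 0" "idempotent b" "b \<noteq> 0" "c = a + b"
      unfolding primitive_idempotent_def by blast
    let ?D = "insert a (insert b (C - {a + b}))"
    have D: "idempotent_system ?D" "card ?D = Suc (card C)"
      using idempotent_system_split[of C a b] C ab that by auto
    have "a + b \<in> span ?D" by (intro span_add span_base) auto
    moreover have "C - {a + b} \<subseteq> span ?D" by (auto intro: span_base)
    ultimately have "C \<subseteq> span ?D" by blast
    then have "span C \<subseteq> span ?D" by (simp add: span_minimal)
    then have "x \<in> span ?D" using C by blast
    then have "card ?D \<le> card C" using max[of ?D] D(1) by blast
    then show False using D(2) by simp
  qed
  then have "jordan_frame C"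
    using C by (simp add: jordan_frame_iff_idempotent_system)
  moreover from this have "finite C" by (simp add: jordan_frame_def)
  then obtain l where "x = (\<Sum>c\<in>C. l c *\<^sub>R c)"
    using C by (auto simp: span_finite)
  ultimately show thesis using that by blast
qed

text \<open>
  Existence of a decomposition makes the choice in the definition of \<open>eigenvalues\<close> meaningful: the
  chosen multiset does come from some Jordan frame.
\<close>

lemma eigenvalues_decomposition:
  fixes x :: "'a::euclidean_jordan_algebra"
  obtains C l where "jordan_frame C" "x = (\<Sum>c\<in>C. l c *\<^sub>R c)"
    "eigenvalues x = image_mset l (mset_set C)"
proof -
  obtain C l where "jordan_frame C" "x = (\<Sum>c\<in>C. l c *\<^sub>R c)"
    by (rule spectral_decomposition)
  then have "\<exists>M C l. jordan_frame C \<and> x = (\<Sum>c\<in>C. l c *\<^sub>R c) \<and> M = image_mset l (mset_set C)"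
    by blast
  from someI_ex[OF this, folded eigenvalues_def] show thesis using that by blast
qed

text \<open>
  As \<open>c \<bullet> c\<close> is the trace of \<open>c\<close>, only the eigenvalues of \<open>c\<close> along the chosen frame matter. They
  are \<open>0\<close> or \<open>1\<close> because \<open>c\<close> is idempotent, and exactly one of them is \<open>1\<close> because \<open>c\<close> is
  primitive and nonzero.
\<close>

lemma norm_primitive_idempotent:
  fixes c :: "'a::euclidean_jordan_algebra"
  assumes "primitive_idempotent c"
  shows "c \<bullet> c = 1"
proof -
  obtain C l where C: "jordan_frame C" and c: "c = (\<Sum>d\<in>C. l d *\<^sub>R d)"
    and ev: "eigenvalues c = image_mset l (mset_set C)"
    by (rule eigenvalues_decomposition)
  have sys: "idempotent_system C" and fin: "finite C"
    using C by (simp_all add: jordan_frame_iff_idempotent_system idempotent_system_def)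
  have idem: "idempotent c" and "c \<noteq> 0"
    and prim: "\<And>a b. idempotent a \<Longrightarrow> idempotent b \<Longrightarrow> a \<noteq> 0 \<Longrightarrow> b \<noteq> 0 \<Longrightarrow> c \<noteq> a + b"
    using assms unfolding primitive_idempotent_def by blast+
  have nz: "d \<noteq> 0" and d_idem: "d \<circ>\<^sub>J d = d" if "d \<in> C" for d
    using sys that by (auto simp: idempotent_system_def idempotent_def)
  have coeff: "l d = 0 \<or> l d = 1" if "d \<in> C" for d
  proof -
    have "l d *\<^sub>R d = d \<circ>\<^sub>J (c \<circ>\<^sub>J c)"
      using idempotent_system_jmult[OF sys that, of l] idem by (simp add: c[symmetric] idempotent_def)
    also have "\<dots> = (l d * l d) *\<^sub>R d"
      unfolding c idempotent_system_square[OF sys] by (rule idempotent_system_jmult[OF sys that])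
    finally show ?thesis using nz[OF that] by simp
  qed
  have "\<exists>d\<in>C. l d \<noteq> 0"
    using \<open>c \<noteq> 0\<close> c by (metis (no_types, lifting) scaleR_zero_left sum.neutral)
  then obtain d where d: "d \<in> C" "l d = 1" using coeff by blast
  define a where "a = (\<Sum>e\<in>C. (if e = d then 0 else l e) *\<^sub>R e)"
  have "c = d + a"
    unfolding c a_def using d fin by (simp add: sum.remove[of C d])
  moreover have "idempotent a"
    unfolding idempotent_def a_def idempotent_system_square[OF sys]
    using coeff by (intro sum.cong) auto
  moreover have "idempotent d" using d_idem d by (simp add: idempotent_def)
  ultimately have "a = 0" using prim nz d by blast
  have "l e = 0" if "e \<in> C" "e \<noteq> d" for e
  proof -
    have "e \<circ>\<^sub>J a = l e *\<^sub>R e"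
      unfolding a_def using idempotent_system_jmult[OF sys that(1)] that(2) by simp
    then show ?thesis using \<open>a = 0\<close> nz[OF that(1)] by (simp add: jmult_zero_right)
  qed
  then have "(\<Sum>e\<in>C. l e) = (\<Sum>e\<in>C. if e = d then 1 else 0)"
    using d by (intro sum.cong) auto
  then have "(\<Sum>e\<in>C. l e) = 1" using fin d by simp
  then have "jtrace c = 1" by (simp add: jtrace_def ev sum_unfold_sum_mset)
  then show ?thesis using idem by (simp add: inner_eq_jtrace idempotent_def)
qed

section \<open>The log-determinant barrier on the symmetric cone\<close>

lemma jordan_frame_system: "jordan_frame C \<Longrightarrow> idempotent_system C"
  by (simp add: jordan_frame_iff_idempotent_system)

lemma jordan_frame_finite: "jordan_frame C \<Longrightarrow> finite C"
  by (simp add: jordan_frame_def)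

lemma jordan_frame_inner:
  fixes C :: "'a::euclidean_jordan_algebra set"
  assumes "jordan_frame C" "c \<in> C"
  shows "c \<bullet> (\<Sum>d\<in>C. l d *\<^sub>R d) = l c"
proof -
  have c: "c \<circ>\<^sub>J c = c" "c \<bullet> c = 1"
    using assms norm_primitive_idempotent
    by (auto simp: jordan_frame_def primitive_idempotent_def idempotent_def)
  have "c \<bullet> (\<Sum>d\<in>C. l d *\<^sub>R d) = c \<bullet> (c \<circ>\<^sub>J (\<Sum>d\<in>C. l d *\<^sub>R d))"
    by (metis c(1) inner_jmult)
  then show ?thesis
    using idempotent_system_jmult[OF jordan_frame_system[OF assms(1)] assms(2), of l] c by simp
qed

text \<open>
  The matrix of inner products of two Jordan frames is doubly stochastic: each frame sums to
  the identity, and \<open>c \<bullet> jone = c \<bullet> c = 1\<close> for a primitive idempotent \<open>c\<close>. All comparisons between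
  spectral data in different frames below go through this matrix.
\<close>

lemma jordan_frames_doubly_stochastic:
  fixes C D :: "'a::euclidean_jordan_algebra set"
  assumes C: "jordan_frame C" and D: "jordan_frame D"
  shows "c \<in> C \<Longrightarrow> d \<in> D \<Longrightarrow> 0 \<le> c \<bullet> d"
    and "c \<in> C \<Longrightarrow> (\<Sum>d\<in>D. c \<bullet> d) = 1"
    and "d \<in> D \<Longrightarrow> (\<Sum>c\<in>C. c \<bullet> d) = 1"
proof -
  have prim: "idempotent c \<and> c \<bullet> c = 1" if "c \<in> C \<or> c \<in> D" for c
    using that C D norm_primitive_idempotent
    by (auto simp: jordan_frame_def primitive_idempotent_def)
  have unit: "c \<bullet> jone = 1" if "c \<in> C \<or> c \<in> D" for c
    using prim[OF that] by (metis idempotent_def inner_jmult jone_right)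
  show "c \<in> C \<Longrightarrow> d \<in> D \<Longrightarrow> 0 \<le> c \<bullet> d"
    using prim inner_idempotents_nonneg by blast
  show "c \<in> C \<Longrightarrow> (\<Sum>d\<in>D. c \<bullet> d) = 1"
    using D unit by (simp add: jordan_frame_def flip: inner_sum_right)
  show "d \<in> D \<Longrightarrow> (\<Sum>c\<in>C. c \<bullet> d) = 1"
    using C unit[of d] by (simp add: jordan_frame_def inner_commute[of _ d] flip: inner_sum_right)
qed

lemma jordan_frames_weighted_sum:
  fixes C D :: "'a::euclidean_jordan_algebra set"
  assumes "jordan_frame C" "jordan_frame D"
  shows "(\<Sum>c\<in>C. \<Sum>d\<in>D. (c \<bullet> d) * (f c + g d)) = (\<Sum>c\<in>C. f c) + (\<Sum>d\<in>D. g d)"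
proof -
  have "(\<Sum>c\<in>C. \<Sum>d\<in>D. (c \<bullet> d) * (f c + g d)) =
      (\<Sum>c\<in>C. \<Sum>d\<in>D. (c \<bullet> d) * f c) + (\<Sum>c\<in>C. \<Sum>d\<in>D. (c \<bullet> d) * g d)"
    by (simp add: distrib_left sum.distrib)
  also have "(\<Sum>c\<in>C. \<Sum>d\<in>D. (c \<bullet> d) * f c) = (\<Sum>c\<in>C. f c)"
    by (simp add: jordan_frames_doubly_stochastic(2)[OF assms] flip: sum_distrib_right)
  also have "(\<Sum>c\<in>C. \<Sum>d\<in>D. (c \<bullet> d) * g d) = (\<Sum>d\<in>D. g d)"
    by (subst sum.swap)
      (simp add: jordan_frames_doubly_stochastic(3)[OF assms] flip: sum_distrib_right)
  finally show ?thesis .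
qed

text \<open>
  Both sides times \<open>c \<bullet> d\<close> equal \<open>(c \<circ>\<^sub>J x) \<bullet> d = c \<bullet> (d \<circ>\<^sub>J x)\<close> for the common value \<open>x\<close> of
  the two sums.
\<close>

lemma jordan_frames_same_coefficient:
  fixes C D :: "'a::euclidean_jordan_algebra set"
  assumes C: "jordan_frame C" and D: "jordan_frame D"
    and eq: "(\<Sum>c\<in>C. l c *\<^sub>R c) = (\<Sum>d\<in>D. m d *\<^sub>R d)"
    and cd: "c \<in> C" "d \<in> D" "c \<bullet> d \<noteq> 0"
  shows "l c = m d"
proof -
  let ?x = "\<Sum>c\<in>C. l c *\<^sub>R c"
  have "l c * (c \<bullet> d) = (c \<circ>\<^sub>J ?x) \<bullet> d"
    using idempotent_system_jmult[OF jordan_frame_system[OF C] cd(1)] by simp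
  also have "\<dots> = c \<bullet> (d \<circ>\<^sub>J ?x)"
    by (metis inner_jmult jmult_commute)
  also have "\<dots> = m d * (c \<bullet> d)"
    unfolding eq using idempotent_system_jmult[OF jordan_frame_system[OF D] cd(2)] by simp
  finally show ?thesis using cd(3) by simp
qed

text \<open>
  The barrier is defined through a chosen frame \<open>D\<close>. Averaging \<open>ln (l c) - ln (m d)\<close> with the
  doubly stochastic weights \<open>c \<bullet> d\<close> gives zero, because the coefficients agree wherever the weight is
  nonzero; hence the sum of logarithms is the same along every frame.
\<close>

lemma barrier_spectral:
  fixes C :: "'a::euclidean_jordan_algebra set"
  assumes C: "jordan_frame C" and pos: "\<And>c. c \<in> C \<Longrightarrow> 0 < l c"
  shows "barrier (\<Sum>c\<in>C. l c *\<^sub>R c) = - (\<Sum>c\<in>C. ln (l c))"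
proof -
  let ?x = "\<Sum>c\<in>C. l c *\<^sub>R c"
  obtain D m where D: "jordan_frame D" and eq: "?x = (\<Sum>d\<in>D. m d *\<^sub>R d)"
    and ev: "eigenvalues ?x = image_mset m (mset_set D)"
    by (rule eigenvalues_decomposition)
  note same = jordan_frames_same_coefficient[OF C D eq]
  have "0 < m d" if "d \<in> D" for d
  proof -
    have "(\<Sum>c\<in>C. c \<bullet> d) \<noteq> 0"
      using jordan_frames_doubly_stochastic(3)[OF C D that] by simp
    then obtain c where "c \<in> C" "c \<bullet> d \<noteq> 0" by (meson sum.neutral)
    then show ?thesis using same that pos by metis
  qed
  moreover have "jdet ?x = (\<Prod>d\<in>D. m d)"
    by (simp add: jdet_def ev prod_unfold_prod_mset)
  ultimately have "barrier ?x = - (\<Sum>d\<in>D. ln (m d))"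
    using jordan_frame_finite[OF D] by (simp add: barrier_def ln_prod less_imp_neq[THEN not_sym])
  moreover have "0 = (\<Sum>c\<in>C. \<Sum>d\<in>D. (c \<bullet> d) * (ln (l c) + - ln (m d)))"
  proof (intro sum.neutral[symmetric] sum.neutral ballI)
    fix c d assume "c \<in> C" "d \<in> D"
    then show "(c \<bullet> d) * (ln (l c) + - ln (m d)) = 0"
      using same[of c d] by (cases "c \<bullet> d = 0") simp_all
  qed
  then have "0 = (\<Sum>c\<in>C. ln (l c)) - (\<Sum>d\<in>D. ln (m d))"
    unfolding jordan_frames_weighted_sum[OF C D] by (simp add: sum_negf)
  ultimately show ?thesis by simp
qed

text \<open>
  The coefficient at \<open>c\<close> is the inner product with \<open>c\<close>, and for a square \<open>y \<circ>\<^sub>J y\<close> this is the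
  quadratic form of multiplication by \<open>c\<close> at \<open>y\<close>.
\<close>

lemma cone_of_squares_iff:
  fixes C :: "'a::euclidean_jordan_algebra set"
  assumes C: "jordan_frame C"
  shows "(\<Sum>c\<in>C. l c *\<^sub>R c) \<in> cone_of_squares \<longleftrightarrow> (\<forall>c\<in>C. 0 \<le> l c)"
proof (intro iffI ballI)
  fix c assume "(\<Sum>c\<in>C. l c *\<^sub>R c) \<in> cone_of_squares" "c \<in> C"
  then obtain y where y: "(\<Sum>c\<in>C. l c *\<^sub>R c) = y \<circ>\<^sub>J y" by (auto simp: cone_of_squares_def)
  have "idempotent c"
    using C \<open>c \<in> C\<close> by (auto simp: jordan_frame_def primitive_idempotent_def)
  have "l c = c \<bullet> (y \<circ>\<^sub>J y)"
    using jordan_frame_inner[OF C \<open>c \<in> C\<close>, of l] y by simp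
  also have "\<dots> = (c \<circ>\<^sub>J y) \<bullet> y" by (metis inner_jmult jmult_commute)
  finally show "0 \<le> l c" by (simp add: inner_jmult_idempotent[OF \<open>idempotent c\<close>])
next
  assume "\<forall>c\<in>C. 0 \<le> l c"
  then have "(\<Sum>c\<in>C. l c *\<^sub>R c) = (\<Sum>c\<in>C. (sqrt (l c) * sqrt (l c)) *\<^sub>R c)"
    by (intro sum.cong) auto
  also have "\<dots> = (\<Sum>c\<in>C. sqrt (l c) *\<^sub>R c) \<circ>\<^sub>J (\<Sum>c\<in>C. sqrt (l c) *\<^sub>R c)"
    by (rule idempotent_system_square[OF jordan_frame_system[OF C], symmetric])
  finally show "(\<Sum>c\<in>C. l c *\<^sub>R c) \<in> cone_of_squares" by (simp add: cone_of_squares_def)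
qed

text \<open>
  An interior point stays in the cone when a small multiple of the identity is subtracted, which lowers
  every coefficient by the same amount. Conversely, if all coefficients of \<open>x\<close> are at least \<open>t\<close>, then
  \<open>d \<bullet> x \<ge> t\<close> for every primitive idempotent \<open>d\<close>, a convex combination by double stochasticity; so the
  eigenvalues of any \<open>u\<close> within distance \<open>t\<close> are nonnegative, whatever its frame.
\<close>

lemma interior_cone_of_squares_iff:
  fixes C :: "'a::euclidean_jordan_algebra set"
  assumes C: "jordan_frame C"
  shows "(\<Sum>c\<in>C. l c *\<^sub>R c) \<in> interior cone_of_squares \<longleftrightarrow> (\<forall>c\<in>C. 0 < l c)"
proof (intro iffI ballI)
  let ?x = "\<Sum>c\<in>C. l c *\<^sub>R c"
  fix c assume "?x \<in> interior cone_of_squares" and c: "c \<in> C"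
  then obtain e where e: "0 < e" "cball ?x e \<subseteq> cone_of_squares"
    by (auto simp: mem_interior_cball)
  define t where "t = e / (norm (jone :: 'a) + 1)"
  have "0 < t" using e(1) by (simp add: t_def add_nonneg_pos)
  have "norm (t *\<^sub>R (jone :: 'a)) \<le> e"
    using e(1) by (simp add: t_def divide_simps mult_left_mono add_nonneg_pos)
  then have "?x - t *\<^sub>R jone \<in> cone_of_squares"
    using e(2) by (auto simp: dist_norm)
  moreover have "?x - t *\<^sub>R jone = (\<Sum>c\<in>C. (l c - t) *\<^sub>R c)"
    using C by (simp add: jordan_frame_def scaleR_diff_left sum_subtractf flip: scaleR_right.sum)
  ultimately have "0 \<le> l c - t"
    using cone_of_squares_iff[OF C, of "\<lambda>c. l c - t"] c by simp
  then show "0 < l c" using \<open>0 < t\<close> by simp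
next
  let ?x = "\<Sum>c\<in>C. l c *\<^sub>R c"
  assume pos: "\<forall>c\<in>C. 0 < l c"
  have fin: "finite C" using jordan_frame_finite[OF C] .
  \<comment> \<open>The \<open>1\<close> only keeps the set nonempty.\<close>
  define t where "t = Min (insert 1 (l ` C))"
  have "0 < t" using pos fin by (simp add: t_def)
  have t: "t \<le> l c" if "c \<in> C" for c using that fin by (simp add: t_def)
  have "ball ?x t \<subseteq> cone_of_squares"
  proof
    fix u assume "u \<in> ball ?x t"
    then have near: "norm (u - ?x) < t" by (simp add: dist_norm norm_minus_commute)
    obtain D m where D: "jordan_frame D" and u: "u = (\<Sum>d\<in>D. m d *\<^sub>R d)"
      by (rule spectral_decomposition)
    have "0 \<le> m d" if d: "d \<in> D" for d
    proof -
      have "norm d = 1"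
        using D d norm_primitive_idempotent by (auto simp: jordan_frame_def norm_eq_1)
      have "t = (\<Sum>c\<in>C. t * (c \<bullet> d))"
        using jordan_frames_doubly_stochastic(3)[OF C D d] by (simp flip: sum_distrib_left)
      also have "\<dots> \<le> (\<Sum>c\<in>C. l c * (c \<bullet> d))"
        using jordan_frames_doubly_stochastic(1)[OF C D _ d] t
        by (intro sum_mono mult_right_mono)
      also have "\<dots> = d \<bullet> ?x" by (simp add: inner_sum_right inner_commute)
      also have "\<dots> = d \<bullet> u - d \<bullet> (u - ?x)" by (simp add: inner_diff_right)
      also have "\<dots> \<le> d \<bullet> u + norm (u - ?x)"
        using Cauchy_Schwarz_ineq2[of d "u - ?x"] \<open>norm d = 1\<close> by simp
      also have "d \<bullet> u = m d" unfolding u by (rule jordan_frame_inner[OF D d])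
      finally show ?thesis using near by simp
    qed
    then show "u \<in> cone_of_squares" unfolding u cone_of_squares_iff[OF D] by blast
  qed
  then show "?x \<in> interior cone_of_squares" using \<open>0 < t\<close> by (auto simp: mem_interior)
qed

text \<open>
  Convexity of the barrier, with the gradient \<open>- y0\<close> at \<open>z0\<close> where \<open>y0\<close> is the inverse of \<open>z0\<close>.
  With \<open>z\<close> decomposed along a second frame, the elementary inequality \<open>1 + ln t \<le> t\<close> for the ratios
  \<open>t = m d / l c\<close>, averaged with the weights \<open>c \<bullet> d\<close>, is the claim: the weighted sum of the
  ratios is \<open>y0 \<bullet> z\<close>, and double stochasticity separates the logarithms.
\<close>

lemma barrier_subgradient:
  fixes C :: "'a::euclidean_jordan_algebra set"
  assumes C: "jordan_frame C" and l: "\<And>c. c \<in> C \<Longrightarrow> 0 < l c"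
    and z: "z \<in> interior cone_of_squares"
  defines "z0 \<equiv> \<Sum>c\<in>C. l c *\<^sub>R c" and "y0 \<equiv> \<Sum>c\<in>C. (1 / l c) *\<^sub>R c"
  shows "barrier z0 - y0 \<bullet> (z - z0) \<le> barrier z"
proof -
  obtain D m where D: "jordan_frame D" and z_eq: "z = (\<Sum>d\<in>D. m d *\<^sub>R d)"
    by (rule spectral_decomposition)
  have m: "0 < m d" if "d \<in> D" for d
    using z that unfolding z_eq interior_cone_of_squares_iff[OF D] by blast
  have "y0 \<bullet> z0 = (\<Sum>c\<in>C. (1 / l c) * (c \<bullet> z0))"
    unfolding y0_def by (simp add: inner_sum_left)
  also have "\<dots> = (\<Sum>c\<in>C. 1)"
    unfolding z0_def using jordan_frame_inner[OF C] l by (intro sum.cong) fastforce+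
  finally have y0z0: "y0 \<bullet> z0 = (\<Sum>c\<in>C. 1)" .
  have "(\<Sum>c\<in>C. 1 - ln (l c)) + (\<Sum>d\<in>D. ln (m d)) =
      (\<Sum>c\<in>C. \<Sum>d\<in>D. (c \<bullet> d) * ((1 - ln (l c)) + ln (m d)))"
    by (rule jordan_frames_weighted_sum[OF C D, symmetric])
  also have "\<dots> \<le> (\<Sum>c\<in>C. \<Sum>d\<in>D. (c \<bullet> d) * (m d / l c))"
  proof (intro sum_mono mult_left_mono)
    fix c d assume "c \<in> C" "d \<in> D"
    then show "1 - ln (l c) + ln (m d) \<le> m d / l c"
      using ln_le_minus_one[of "m d / l c"] l m by (simp add: ln_div less_imp_neq[THEN not_sym])
    show "0 \<le> c \<bullet> d"
      using jordan_frames_doubly_stochastic(1)[OF C D] \<open>c \<in> C\<close> \<open>d \<in> D\<close> .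
  qed
  also have "\<dots> = y0 \<bullet> z"
    unfolding y0_def inner_sum_left unfolding z_eq inner_sum_right by (simp add: mult_ac)
  finally have "(\<Sum>c\<in>C. 1) - (\<Sum>c\<in>C. ln (l c)) + (\<Sum>d\<in>D. ln (m d)) \<le> y0 \<bullet> z"
    by (simp add: sum_subtractf)
  moreover have "barrier z0 = - (\<Sum>c\<in>C. ln (l c))"
    unfolding z0_def using C l by (rule barrier_spectral)
  moreover have "barrier z = - (\<Sum>d\<in>D. ln (m d))"
    unfolding z_eq using D m by (rule barrier_spectral)
  ultimately show ?thesis using y0z0 by (simp add: inner_diff_right)
qed

section \<open>The proximal point of the barrier\<close>

text \<open>
  \<open>- y\<close> is a subgradient at \<open>z\<close> of \<open>\<mu> * barrier\<close> on the interior of the cone. With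
  \<open>y = s + \<rho> *\<^sub>R (z - x)\<close> this is the optimality condition for the proximal problem at \<open>(x, s)\<close>.
\<close>

definition barrier_stationary :: "real \<Rightarrow> 'a::euclidean_jordan_algebra \<Rightarrow> 'a \<Rightarrow> bool" where
  "barrier_stationary \<mu> y z \<longleftrightarrow> z \<in> interior cone_of_squares \<and>
     (\<forall>z' \<in> interior cone_of_squares. \<mu> * barrier z - y \<bullet> (z' - z) \<le> \<mu> * barrier z')"

text \<open>
  Along a frame that diagonalises \<open>\<rho> *\<^sub>R x - s\<close> the condition \<open>s + \<rho> *\<^sub>R (z - x) = \<mu> *\<^sub>R z\<^sup>-\<^sup>1\<close> decouples
  into the scalar equations \<open>\<rho> l - w = \<mu> / l\<close>, whose positive root is \<open>l c\<close>.
\<close>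

lemma barrier_stationary_exists:
  fixes x s :: "'a::euclidean_jordan_algebra"
  assumes \<mu>: "0 < \<mu>" and \<rho>: "0 < \<rho>"
  obtains z where "barrier_stationary \<mu> (s + \<rho> *\<^sub>R (z - x)) z"
proof -
  obtain C w where C: "jordan_frame C" and w: "\<rho> *\<^sub>R x - s = (\<Sum>c\<in>C. w c *\<^sub>R c)"
    by (rule spectral_decomposition)
  define l where "l c = (w c + sqrt ((w c)\<^sup>2 + 4 * \<rho> * \<mu>)) / (2 * \<rho>)" for c
  have l_pos: "0 < l c" and l_root: "\<rho> * l c - w c = \<mu> * (1 / l c)" for c
  proof -
    define q where "q = sqrt ((w c)\<^sup>2 + 4 * \<rho> * \<mu>)"
    have "q * q = (w c)\<^sup>2 + 4 * \<rho> * \<mu>" using \<mu> \<rho> by (simp add: q_def)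
    have "\<bar>w c\<bar> < q"
      unfolding q_def using \<mu> \<rho> by (intro real_less_rsqrt) simp
    then show "0 < l c" using \<rho> by (simp add: l_def q_def[symmetric])
    have l_q: "l c = (w c + q) / (2 * \<rho>)" by (simp add: l_def q_def)
    have "(\<rho> * l c - w c) * l c = (q * q - (w c)\<^sup>2) / (4 * \<rho>)"
      using \<rho> by (simp add: l_q field_simps power2_eq_square)
    then have "(\<rho> * l c - w c) * l c = \<mu>"
      using \<rho> by (simp add: \<open>q * q = _\<close>)
    then show "\<rho> * l c - w c = \<mu> * (1 / l c)" using \<open>0 < l c\<close> by (simp add: field_simps)
  qed
  define z where "z = (\<Sum>c\<in>C. l c *\<^sub>R c)"
  define y where "y = (\<Sum>c\<in>C. (1 / l c) *\<^sub>R c)"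
  have "s + \<rho> *\<^sub>R (z - x) = \<rho> *\<^sub>R z - (\<rho> *\<^sub>R x - s)" by (simp add: algebra_simps)
  also have "\<dots> = (\<Sum>c\<in>C. (\<rho> * l c - w c) *\<^sub>R c)"
    unfolding w z_def by (simp add: scaleR_right.sum scaleR_diff_left sum_subtractf)
  also have "\<dots> = \<mu> *\<^sub>R y"
    unfolding y_def by (simp add: l_root scaleR_right.sum)
  finally have grad: "s + \<rho> *\<^sub>R (z - x) = \<mu> *\<^sub>R y" .
  have "z \<in> interior cone_of_squares"
    unfolding z_def interior_cone_of_squares_iff[OF C] using l_pos by blast
  moreover have "\<mu> * barrier z - (\<mu> *\<^sub>R y) \<bullet> (z' - z) \<le> \<mu> * barrier z'"
    if "z' \<in> interior cone_of_squares" for z'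
    using mult_left_mono[OF barrier_subgradient[OF C l_pos that], of \<mu>] \<mu>
    unfolding z_def y_def by (simp add: right_diff_distrib)
  ultimately show thesis
    using that[of z] unfolding barrier_stationary_def grad by blast
qed

text \<open>
  A stationary point is a strong minimiser: the barrier lies above its linearisation and the quadratic
  term is expanded exactly.
\<close>

lemma barrier_stationary_growth:
  fixes x s z z' :: "'a::euclidean_jordan_algebra"
  assumes "barrier_stationary \<mu> (s + \<rho> *\<^sub>R (z - x)) z" "z' \<in> interior cone_of_squares"
  shows "\<mu> * barrier z + s \<bullet> z + \<rho> / 2 * (norm (z - x))\<^sup>2 + \<rho> / 2 * (norm (z' - z))\<^sup>2
    \<le> \<mu> * barrier z' + s \<bullet> z' + \<rho> / 2 * (norm (z' - x))\<^sup>2"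
proof -
  have "z' - x = (z' - z) + (z - x)" by simp
  then have "(norm (z' - x))\<^sup>2 = (norm (z' - z))\<^sup>2 + 2 * ((z - x) \<bullet> (z' - z)) + (norm (z - x))\<^sup>2"
    by (metis (no_types, lifting) inner_commute power2_norm_eq_inner inner_add_left inner_add_right add.assoc mult_2)
  then have "\<rho> / 2 * (norm (z' - x))\<^sup>2 =
      \<rho> / 2 * (norm (z' - z))\<^sup>2 + \<rho> * ((z - x) \<bullet> (z' - z)) + \<rho> / 2 * (norm (z - x))\<^sup>2"
    by (simp add: distrib_left)
  moreover have "(s + \<rho> *\<^sub>R (z - x)) \<bullet> (z' - z) = s \<bullet> z' - s \<bullet> z + \<rho> * ((z - x) \<bullet> (z' - z))"
    by (simp only: inner_add_left inner_scaleR_left inner_diff_right[of s])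
  moreover have "\<mu> * barrier z - (s + \<rho> *\<^sub>R (z - x)) \<bullet> (z' - z) \<le> \<mu> * barrier z'"
    using assms by (simp add: barrier_stationary_def)
  ultimately show ?thesis by linarith
qed

lemma z_min_eqI:
  fixes x s z :: "'a::euclidean_jordan_algebra"
  assumes st: "barrier_stationary \<mu> (s + \<rho> *\<^sub>R (z - x)) z" and \<rho>: "0 < \<rho>"
  shows "z_min \<rho> x s \<mu> = z"
  unfolding z_min_def
proof (rule arg_minI)
  show z: "z \<in> interior cone_of_squares" using st by (simp add: barrier_stationary_def)
  fix y :: 'a assume y: "y \<in> interior cone_of_squares"
  note growth = barrier_stationary_growth[OF st y]
  have "0 \<le> \<rho> / 2 * (norm (y - z))\<^sup>2" using \<rho> by simp
  then show "\<not> \<mu> * barrier y + s \<bullet> y + \<rho> / 2 * (norm (y - x))\<^sup>2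
      < \<mu> * barrier z + s \<bullet> z + \<rho> / 2 * (norm (z - x))\<^sup>2"
    using growth by linarith
  assume "\<forall>v. v \<in> interior cone_of_squares \<longrightarrow>
    \<not> \<mu> * barrier v + s \<bullet> v + \<rho> / 2 * (norm (v - x))\<^sup>2
      < \<mu> * barrier y + s \<bullet> y + \<rho> / 2 * (norm (y - x))\<^sup>2"
  then have "\<rho> / 2 * (norm (y - z))\<^sup>2 \<le> 0" using growth z by force
  then show "y = z" using \<rho> by (simp add: mult_le_0_iff)
qed

lemma z_min_stationary:
  assumes "0 < \<mu>" "0 < \<rho>"
  shows "barrier_stationary \<mu> (s + \<rho> *\<^sub>R (z_min \<rho> x s \<mu> - x)) (z_min \<rho> x s \<mu>)"
proof -
  obtain z where "barrier_stationary \<mu> (s + \<rho> *\<^sub>R (z - x)) z"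
    using barrier_stationary_exists[OF assms] .
  then show ?thesis using z_min_eqI[OF _ assms(2)] by metis
qed

text \<open>
  The function of \<open>z\<close> whose minimum over the interior of the cone is \<open>eta\<close>, with
  \<open>x = xbar + B xh\<close>.
\<close>

definition aug_lagrangian ::
    "'a::euclidean_jordan_algebra \<Rightarrow> real \<Rightarrow> real \<Rightarrow> 'a \<Rightarrow> 'a \<Rightarrow> 'a \<Rightarrow> real" where
  "aug_lagrangian c \<rho> \<mu> x s z =
     c \<bullet> x + \<mu> * barrier z + s \<bullet> (z - x) + \<rho> / 2 * (norm (z - x))\<^sup>2"

lemma eta_eqI:
  fixes c xbar s z :: "'a::euclidean_jordan_algebra"
  assumes st: "barrier_stationary \<mu> (s + \<rho> *\<^sub>R (z - x)) z" and \<rho>: "0 < \<rho>"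
    and x: "x = xbar + B xh"
  shows "eta c xbar B \<rho> xh s \<mu> = aug_lagrangian c \<rho> \<mu> x s z"
  unfolding eta_def Let_def x[symmetric]
proof (rule Least_equality)
  show "aug_lagrangian c \<rho> \<mu> x s z \<in> (\<lambda>z. c \<bullet> x + \<mu> * barrier z + s \<bullet> (z - x)
      + \<rho> / 2 * (norm (z - x))\<^sup>2) ` interior cone_of_squares"
    using st by (auto simp: barrier_stationary_def aug_lagrangian_def)
next
  fix v assume "v \<in> (\<lambda>z. c \<bullet> x + \<mu> * barrier z + s \<bullet> (z - x)
      + \<rho> / 2 * (norm (z - x))\<^sup>2) ` interior cone_of_squares"
  then obtain z' :: 'a where z': "z' \<in> interior cone_of_squares"
    and v: "v = c \<bullet> x + \<mu> * barrier z' + s \<bullet> (z' - x) + \<rho> / 2 * (norm (z' - x))\<^sup>2"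
    by blast
  have "0 \<le> \<rho> / 2 * (norm (z' - z))\<^sup>2" using \<rho> by simp
  then show "aug_lagrangian c \<rho> \<mu> x s z \<le> v"
    using barrier_stationary_growth[OF st z']
    by (simp add: v aug_lagrangian_def inner_diff_right)
qed

lemma eta_le:
  fixes c xbar s z' :: "'a::euclidean_jordan_algebra"
  assumes "0 < \<mu>" "0 < \<rho>" and x: "x = xbar + B xh" and z': "z' \<in> interior cone_of_squares"
  shows "eta c xbar B \<rho> xh s \<mu> \<le> aug_lagrangian c \<rho> \<mu> x s z'"
proof -
  note st = z_min_stationary[OF assms(1,2), of s x]
  have "0 \<le> \<rho> / 2 * (norm (z' - z_min \<rho> x s \<mu>))\<^sup>2" using assms by simp
  then show ?thesis
    using barrier_stationary_growth[OF st z'] eta_eqI[where B=B and xh=xh, OF st assms(2) x]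
    by (simp add: aug_lagrangian_def inner_diff_right)
qed

section \<open>Saddle points\<close>

text \<open>
  An injective map sends a basis to an independent set, here inside the kernel and of full size.
\<close>

lemma range_eq_kernel:
  fixes A :: "'e::euclidean_space \<Rightarrow> 'f::real_vector" and B :: "'h::real_vector \<Rightarrow> 'e"
  assumes B: "linear B" "inj B" and AB: "\<And>h. A (B h) = 0"
    and dim: "dim (UNIV :: 'h set) = dim {x. A x = 0}"
  shows "range B = {x. A x = 0}"
proof -
  obtain S :: "'h set" where S: "independent S" "span S = UNIV" "card S = dim (UNIV :: 'h set)"
    using basis_exists[of UNIV] by (metis top.extremum_uniqueI)
  have ind: "independent (B ` S)"
    using linear_independent_injective_image[OF B(1) S(1)] B(2) by (simp add: inj_on_subset)
  have "card (B ` S) = dim {x. A x = 0}"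
    using card_image[of B S] B(2) S(3) dim by (simp add: inj_on_subset)
  then have "{x. A x = 0} \<subseteq> span (B ` S)"
    using ind AB independent_bound by (intro card_ge_dim_independent) auto
  then show ?thesis
    using AB linear_span_image[OF B(1), of S] S(2) by auto
qed

text \<open>
  Write \<open>v = a + r\<close> with \<open>a\<close> in the range of the adjoint and \<open>r\<close> orthogonal to it. Then \<open>A r = 0\<close>, so
  \<open>v \<bullet> r = 0\<close>, and \<open>r\<close> is orthogonal to itself.
\<close>

lemma orthogonal_kernel_in_range_adjoint:
  fixes A :: "'e::euclidean_space \<Rightarrow> 'f::euclidean_space"
  assumes A: "linear A" and orth: "\<And>d. A d = 0 \<Longrightarrow> v \<bullet> d = 0"
  shows "v \<in> range (adjoint A)"
proof -
  have adj: "linear (adjoint A)" by (rule adjoint_linear[OF A])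
  have sub: "span (range (adjoint A)) = range (adjoint A)"
    by (simp add: span_eq_iff linear_subspace_image[OF adj])
  obtain a r where a: "a \<in> range (adjoint A)"
    and r: "\<And>w. w \<in> range (adjoint A) \<Longrightarrow> orthogonal r w" and v: "v = a + r"
    using orthogonal_subspace_decomp_exists[of "range (adjoint A)" v] unfolding sub by blast
  have "A r \<bullet> A r = r \<bullet> adjoint A (A r)" by (simp add: adjoint_works[OF A] inner_commute)
  also have "\<dots> = 0" using r by (simp add: orthogonal_def)
  finally have "v \<bullet> r = 0" using orth by simp
  moreover have "a \<bullet> r = 0" using r[OF a] by (simp add: orthogonal_def inner_commute)
  ultimately have "r = 0" by (simp add: v inner_add_left)
  then show ?thesis using a v by simp
qed

text \<open>
  Surjectivity of \<open>A\<close> makes the adjoint injective, hence \<open>A \<circ> adjoint A\<close> is injective and its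
  inverse undoes it on the preimage of \<open>v\<close>.
\<close>

lemma multiplier_recovery:
  fixes A :: "'e::euclidean_space \<Rightarrow> 'f::euclidean_space"
  assumes A: "linear A" "surj A" and v: "v \<in> range (adjoint A)"
  shows "adjoint A (inv (A \<circ> adjoint A) (A v)) = v"
proof -
  have adj: "linear (adjoint A)" by (rule adjoint_linear[OF A(1)])
  have "inj (A \<circ> adjoint A)"
  proof (subst linear_injective_0)
    show "linear (A \<circ> adjoint A)" using adj A(1) by (rule linear_compose)
    show "\<forall>l. (A \<circ> adjoint A) l = 0 \<longrightarrow> l = 0"
    proof (intro allI impI)
      fix l assume l: "(A \<circ> adjoint A) l = 0"
      have "adjoint A l \<bullet> adjoint A l = A (adjoint A l) \<bullet> l"
        by (rule adjoint_works[OF A(1)])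
      then have "adjoint A l = 0" using l by simp
      obtain x where "l = A x" using A(2) by blast
      then have "l \<bullet> l = x \<bullet> adjoint A l"
        by (simp add: adjoint_works[OF A(1)])
      then show "l = 0" using \<open>adjoint A l = 0\<close> by simp
    qed
  qed
  moreover obtain l where "v = adjoint A l" using v by blast
  ultimately show ?thesis using inv_f_f[of "A \<circ> adjoint A" l] by simp
qed

text \<open>
  A quadratic that vanishes at the origin and is nonnegative everywhere has no linear term.
\<close>

lemma linear_coeff_eq_0:
  fixes a k :: real
  assumes "\<And>t. 0 \<le> t * a + t\<^sup>2 * k"
  shows "a = 0"
proof (rule ccontr)
  assume "a \<noteq> 0"
  \<comment> \<open>Any \<open>n > 0\<close> with \<open>n > k\<close> works in the test point \<open>- a / n\<close>.\<close>
  define n where "n = 2 * (\<bar>k\<bar> + 1)"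
  have "0 < n" by (simp add: n_def add_nonneg_pos)
  have "0 \<le> (- a / n) * a + (- a / n)\<^sup>2 * k" by (rule assms)
  also have "\<dots> = (a\<^sup>2 / n\<^sup>2) * (k - n)"
    using \<open>0 < n\<close> by (simp add: field_simps power2_eq_square)
  also have "\<dots> < 0"
    using \<open>a \<noteq> 0\<close> \<open>0 < n\<close> by (intro mult_pos_neg) (auto simp: n_def)
  finally show False by simp
qed

text \<open>
  Since \<open>x\<close> is its own proximal point, \<open>eta\<close> at \<open>(xh, s)\<close> equals \<open>c \<bullet> x + \<mu> * barrier x\<close>. Inserting
  \<open>z = x\<close> bounds \<open>eta\<close> at \<open>(xh, s')\<close> by this value for every \<open>s'\<close>. For \<open>xh'\<close>, the difference \<open>x' - x\<close> lies
  in the kernel of \<open>A\<close>, where \<open>c\<close> and \<open>s\<close> agree by dual feasibility; the value at \<open>z'\<close> is then at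
  least \<open>c \<bullet> x + \<mu> * barrier z' + s \<bullet> (z' - x)\<close>, and \<open>- s\<close> is a subgradient of \<open>\<mu> * barrier\<close>
  at \<open>x\<close>.
\<close>

lemma saddle_point_if_smooth_system:
  fixes A :: "'e::euclidean_jordan_algebra \<Rightarrow> 'f::euclidean_space" and B :: "'h \<Rightarrow> 'e"
  assumes \<mu>: "0 < \<mu>" and \<rho>: "0 < \<rho>" and A: "linear A" and AB: "\<And>h. A (B h) = 0"
    and sol: "solves_smooth_system A b c \<rho> \<mu> x s l"
    and x: "x = xbar + B xh" and xbar: "A xbar = b"
  shows "saddle_point (\<lambda>xh s. eta c xbar B \<rho> xh s \<mu>) xh s"
proof -
  have dual: "adjoint A l + s = c" and z: "z_min \<rho> x s \<mu> = x"
    using sol by (simp_all add: solves_smooth_system_def Phi_def)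
  have st: "barrier_stationary \<mu> (s + \<rho> *\<^sub>R (x - x)) x"
    using z_min_stationary[OF \<mu> \<rho>, of s x] by (simp add: z)
  then have st': "x \<in> interior cone_of_squares"
    "\<And>z. z \<in> interior cone_of_squares \<Longrightarrow> \<mu> * barrier x - s \<bullet> (z - x) \<le> \<mu> * barrier z"
    by (simp_all add: barrier_stationary_def)
  have val: "eta c xbar B \<rho> xh s \<mu> = c \<bullet> x + \<mu> * barrier x"
    using eta_eqI[where B=B and xh=xh, OF st \<rho> x, of c] by (simp add: aug_lagrangian_def)
  have "eta c xbar B \<rho> xh s' \<mu> \<le> eta c xbar B \<rho> xh s \<mu>" for s'
    using eta_le[where B=B and xh=xh, OF \<mu> \<rho> x st'(1), of c s'] by (simp add: val aug_lagrangian_def)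
  moreover have "eta c xbar B \<rho> xh s \<mu> \<le> eta c xbar B \<rho> xh' s \<mu>" for xh'
  proof -
    define x' where "x' = xbar + B xh'"
    define z' where "z' = z_min \<rho> x' s \<mu>"
    have z': "barrier_stationary \<mu> (s + \<rho> *\<^sub>R (z' - x')) z'"
      unfolding z'_def by (rule z_min_stationary[OF \<mu> \<rho>])
    have "A (x' - x) = 0"
      by (simp add: x'_def x linear_diff[OF A] linear_add[OF A] AB)
    then have "adjoint A l \<bullet> (x' - x) = 0"
      by (simp add: adjoint_works[OF A] inner_commute)
    then have cs: "c \<bullet> (x' - x) = s \<bullet> (x' - x)"
      by (simp add: dual[symmetric] inner_add_left)
    have "\<mu> * barrier x - s \<bullet> (z' - x) \<le> \<mu> * barrier z'"
      using st'(2) z' by (simp add: barrier_stationary_def)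
    moreover have "0 \<le> \<rho> / 2 * (norm (z' - x'))\<^sup>2" using \<rho> by simp
    ultimately have "c \<bullet> x + \<mu> * barrier x \<le> aug_lagrangian c \<rho> \<mu> x' s z'"
      using cs by (simp add: aug_lagrangian_def inner_diff_right)
    then show ?thesis
      using eta_eqI[where B=B and xh=xh', OF z' \<rho> x'_def, of c] by (simp add: val)
  qed
  ultimately show ?thesis by (simp add: saddle_point_def)
qed

text \<open>
  Maximality in \<open>s\<close> forces the proximal point \<open>z\<close> to be \<open>x\<close>: otherwise adding \<open>\<rho> (z - x)\<close> to \<open>s\<close>
  increases \<open>eta\<close>. Minimality in \<open>xh\<close> is then tested with the fixed trial point \<open>z = x\<close>,
  which leaves a quadratic in the step along a kernel direction \<open>d\<close>; its linear coefficient
  \<open>(c - s) \<bullet> d\<close> vanishes, so \<open>c - s\<close> is in the range of the adjoint.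
\<close>

lemma smooth_system_if_saddle_point:
  fixes A :: "'e::euclidean_jordan_algebra \<Rightarrow> 'f::euclidean_space" and B :: "'h::real_vector \<Rightarrow> 'e"
  assumes \<mu>: "0 < \<mu>" and \<rho>: "0 < \<rho>" and A: "linear A" "surj A"
    and B: "linear B" "range B = {d. A d = 0}"
    and saddle: "saddle_point (\<lambda>xh s. eta c xbar B \<rho> xh s \<mu>) xh s"
    and x: "x = xbar + B xh" and xbar: "A xbar = b"
  shows "solves_smooth_system A b c \<rho> \<mu> x s (inv (A \<circ> adjoint A) (A (c - s)))"
proof -
  define z where "z = z_min \<rho> x s \<mu>"
  define g where "g = z - x"
  have st: "barrier_stationary \<mu> (s + \<rho> *\<^sub>R (z - x)) z"
    unfolding z_def by (rule z_min_stationary[OF \<mu> \<rho>])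
  have val: "eta c xbar B \<rho> xh s \<mu> = aug_lagrangian c \<rho> \<mu> x s z"
    using eta_eqI[where B=B and xh=xh, OF st \<rho> x] .
  have "z = x"
  proof -
    \<comment> \<open>\<open>eta\<close> is concave in \<open>s\<close> with supergradient \<open>g\<close>; for this step the increase is at least a
      positive multiple of a sum of squares.\<close>
    define s' where "s' = s + \<rho> *\<^sub>R g"
    define z' where "z' = z_min \<rho> x s' \<mu>"
    have st': "barrier_stationary \<mu> (s' + \<rho> *\<^sub>R (z' - x)) z'"
      unfolding z'_def by (rule z_min_stationary[OF \<mu> \<rho>])
    then have "z' \<in> interior cone_of_squares" by (simp add: barrier_stationary_def)
    note growth = barrier_stationary_growth[OF st this]
    have "aug_lagrangian c \<rho> \<mu> x s' z' =
        aug_lagrangian c \<rho> \<mu> x s z' + \<rho> * (g \<bullet> (z' - x))"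
      by (simp add: aug_lagrangian_def s'_def inner_add_left)
    moreover have "aug_lagrangian c \<rho> \<mu> x s z + \<rho> / 2 * (norm (z' - z))\<^sup>2
        \<le> aug_lagrangian c \<rho> \<mu> x s z'"
      using growth by (simp add: aug_lagrangian_def inner_diff_right)
    moreover have "eta c xbar B \<rho> xh s' \<mu> \<le> eta c xbar B \<rho> xh s \<mu>"
      using saddle unfolding saddle_point_def by blast
    then have "aug_lagrangian c \<rho> \<mu> x s' z' \<le> aug_lagrangian c \<rho> \<mu> x s z"
      using eta_eqI[where B=B and xh=xh, OF st' \<rho> x, of c] by (simp add: val)
    ultimately have le: "\<rho> * ((norm (z' - z))\<^sup>2 / 2 + g \<bullet> (z' - x)) \<le> 0"
      by (simp add: distrib_left)
    define d where "d = z' - z"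
    have "z' - x = d + g" by (simp add: g_def d_def)
    then have "(norm (z' - x))\<^sup>2 = (norm d)\<^sup>2 + 2 * (g \<bullet> d) + g \<bullet> g"
      and "g \<bullet> (z' - x) = g \<bullet> d + g \<bullet> g"
      by (simp_all add: power2_norm_eq_inner inner_add_left inner_add_right inner_commute[of d g])
    then have "(norm (z' - z))\<^sup>2 / 2 + g \<bullet> (z' - x) = ((norm (z' - x))\<^sup>2 + g \<bullet> g) / 2"
      by (simp add: d_def)
    then have "(norm (z' - x))\<^sup>2 + g \<bullet> g \<le> 0"
      using le \<rho> by (simp add: mult_le_0_iff)
    then have "g \<bullet> g \<le> 0" by (smt (verit) zero_le_power2)
    then have "g \<bullet> g = 0" using inner_ge_zero[of g] by linarith
    then show ?thesis by (simp add: g_def)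
  qed
  then have phi: "Phi \<rho> x s \<mu> = 0" by (simp add: Phi_def z_def)
  have x_int: "x \<in> interior cone_of_squares"
    using st \<open>z = x\<close> by (simp add: barrier_stationary_def)
  have "(c - s) \<bullet> d = 0" if "A d = 0" for d
  proof (rule linear_coeff_eq_0)
    fix t :: real
    have "d \<in> range B" using B(2) that by simp
    then obtain h where "d = B h" by blast
    then have x': "x + t *\<^sub>R d = xbar + B (xh + t *\<^sub>R h)"
      by (simp add: x linear_add[OF B(1)] linear_scale[OF B(1)])
    have "eta c xbar B \<rho> xh s \<mu> \<le> eta c xbar B \<rho> (xh + t *\<^sub>R h) s \<mu>"
      using saddle unfolding saddle_point_def by blast
    also have "\<dots> \<le> aug_lagrangian c \<rho> \<mu> (x + t *\<^sub>R d) s x"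
      by (rule eta_le[where B=B, OF \<mu> \<rho> x' x_int])
    finally have "aug_lagrangian c \<rho> \<mu> x s x \<le> aug_lagrangian c \<rho> \<mu> (x + t *\<^sub>R d) s x"
      by (simp only: val \<open>z = x\<close>)
    then show "0 \<le> t * ((c - s) \<bullet> d) + t\<^sup>2 * (\<rho> / 2 * (norm d)\<^sup>2)"
      by (simp add: aug_lagrangian_def inner_add_right inner_diff_left power_mult_distrib algebra_simps)
  qed
  then have "c - s \<in> range (adjoint A)"
    by (rule orthogonal_kernel_in_range_adjoint[OF A(1)])
  then have "adjoint A (inv (A \<circ> adjoint A) (A (c - s))) = c - s"
    by (rule multiplier_recovery[OF A])
  moreover have "A (B xh) = 0" using B(2) by blast
  then have "A x = b" by (simp add: x linear_add[OF A(1)] xbar)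
  ultimately show ?thesis
    using phi by (simp add: solves_smooth_system_def)
qed

theorem theorem6:
  fixes A :: "'e::euclidean_jordan_algebra \<Rightarrow> real ^ 'm"
    and b :: "real ^ 'm"
    and c xbar :: 'e
    and B :: "'h::real_inner \<Rightarrow> 'e"
    and \<mu> \<rho> :: real
    and \<nu> :: nat
  assumes rank: "jrank TYPE('e) = \<nu>"
    and A: "linear A" "surj A"
    and slater_primal: "\<exists>x \<in> interior cone_of_squares. A x = b"
    and slater_dual: "\<exists>l. \<exists>s \<in> interior cone_of_squares. adjoint A l + s = c"
    and xbar: "A xbar = b"
    and fin_dim: "\<exists>S :: 'h set. finite S \<and> span S = UNIV"
    and dim: "dim (UNIV :: 'h set) = dim {x. A x = 0}"
    and B: "linear B" "inj B"
    and AB: "\<And>h. A (B h) = 0"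
    and BB: "\<And>h. adjoint B (B h) = h"
    and \<mu>: "\<mu> > 0"
    and \<rho>: "\<rho> > 0"
  shows "(\<forall>x s l. solves_smooth_system A b c \<rho> \<mu> x s l \<longrightarrow>
            saddle_point (\<lambda>xh s'. eta c xbar B \<rho> xh s' \<mu>) (adjoint B (x - xbar)) s) \<and>
         (\<forall>xh s. saddle_point (\<lambda>xh' s'. eta c xbar B \<rho> xh' s' \<mu>) xh s \<longrightarrow>
            solves_smooth_system A b c \<rho> \<mu> (xbar + B xh) s
              (inv (A \<circ> adjoint A) (A (c - s))))"
proof (intro conjI allI impI)
  have range: "range B = {d. A d = 0}"
    using range_eq_kernel[OF B AB dim] .
  fix x s l
  assume sol: "solves_smooth_system A b c \<rho> \<mu> x s l"
  then have "A (x - xbar) = 0"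
    by (simp add: solves_smooth_system_def linear_diff[OF A(1)] xbar)
  then obtain h where h: "x - xbar = B h" using range by blast
  then have x: "x = xbar + B h" by (metis diff_add_cancel add.commute)
  have "saddle_point (\<lambda>xh s'. eta c xbar B \<rho> xh s' \<mu>) h s"
    by (rule saddle_point_if_smooth_system[where B=B, OF \<mu> \<rho> A(1) AB sol x xbar])
  then show "saddle_point (\<lambda>xh s'. eta c xbar B \<rho> xh s' \<mu>) (adjoint B (x - xbar)) s"
    by (simp add: h BB)
next
  have range: "range B = {d. A d = 0}"
    using range_eq_kernel[OF B AB dim] .
  fix xh s
  assume "saddle_point (\<lambda>xh' s'. eta c xbar B \<rho> xh' s' \<mu>) xh s"
  then show "solves_smooth_system A b c \<rho> \<mu> (xbar + B xh) s
      (inv (A \<circ> adjoint A) (A (c - s)))"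
    by (rule smooth_system_if_saddle_point[OF \<mu> \<rho> A B(1) range _ refl xbar])
qed

end
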